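(* Let $(M,d)$ be a proper metric space (closed balls are compact). Let $(X_n)_{n\ge 0}$ be an $M$-valued Markov chain defined on a probability space $(\Omega,\mathcal A,P)$, with an ergodic (invariant) probability measure $\lambda$ of its transition kernel, and assume $X_0\sim\lambda$. Assume that the Fréchet function $$\mathcal F(p)=\int_M d^2(x,p)\,\lambda(dx)$$ is finite at some point $p_0\in M$. Let $\mathcal U$ denote the set of minimisers of $\mathcal F$ on $M$, and for $n\ge 1$ let $\mathcal U_n$ denote the (random) set of minimisers on $M$ of the sample Fréchet function $$\mathcal F_n(p)=\frac1n\sum_{k=0}^{n-1} d^2(X_k,p).$$ Then $$\sup_{q\in\mathcal U_n} d(q,\mathcal U)\longrightarrow 0\quad\text{as } n\to\infty,\quad P\text{-almost surely},$$ where $d(q,\mathcal U)=\inf_{y\in\mathcal U} d(q,y)$.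
   Context: $M$ carries its Borel $\sigma$-algebra $\mathcal B(M)$. A Markov kernel $\mathcal K:M\times\mathcal B(M)\to[0,1]$ is measurable in the first variable and a probability measure in the second. An adapted process $(X_n)_{n\ge0}$ on $(\Omega,\mathcal A,P)$ with a filtration $(\mathcal A_n)_{n\ge 0}$ is a Markov chain with kernel $\mathcal K$ if $P(X_{n+1}\in B\mid\mathcal A_n)=\mathcal K(X_n,B)$ a.s. for all $n\ge0$ and $B\in\mathcal B(M)$. A probability measure $\lambda$ is invariant if $\lambda(B)=\int_M\mathcal K(x,B)\,\lambda(dx)$ for all $B$. An invariant probability measure $\lambda$ is ergodic if every bounded measurable $f:M\to\mathbb R$ with $\int_M f(y)\,\mathcal K(x,dy)=f(x)$ for $\lambda$-a.e. $x$ is $\lambda$-a.s. constant. *)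

theory Defs
  imports "HOL-Probability.Probability"
begin

text \<open>
  The state space is a metric space type with its Borel sigma-algebra. A Markov kernel \<open>K\<close> is
  a measurable map into the Giry space \<^term>\<open>prob_algebra borel\<close>: every \<open>K x\<close> is a Borel
  probability measure, and \<open>\<lambda>x. emeasure (K x) B\<close> is measurable for every Borel set \<open>B\<close>.
\<close>

definition markov_kernel :: "('a::metric_space \<Rightarrow> 'a measure) \<Rightarrow> bool" where
  "markov_kernel K \<longleftrightarrow> K \<in> borel \<rightarrow>\<^sub>M prob_algebra borel"

definition markov_chain ::
  "'w measure \<Rightarrow> (nat \<Rightarrow> 'w measure) \<Rightarrow> ('a::metric_space \<Rightarrow> 'a measure) \<Rightarrow> (nat \<Rightarrow> 'w \<Rightarrow> 'a) \<Rightarrow> bool"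
where
  "markov_chain P A K X \<longleftrightarrow>
     prob_space P \<and> markov_kernel K \<and>
     filtration (space P) A \<and> (\<forall>n. subalgebra P (A n)) \<and>
     (\<forall>n. X n \<in> A n \<rightarrow>\<^sub>M borel) \<and>
     (\<forall>n. \<forall>B\<in>sets borel. AE w in P.
        real_cond_exp P (A n) (indicator (X (Suc n) -` B \<inter> space P)) w = measure (K (X n w)) B)"

definition invariant_prob :: "('a::metric_space \<Rightarrow> 'a measure) \<Rightarrow> 'a measure \<Rightarrow> bool" where
  "invariant_prob K L \<longleftrightarrow>
     prob_space L \<and> sets L = sets borel \<and>
     (\<forall>B\<in>sets borel. emeasure L B = (\<integral>\<^sup>+ x. emeasure (K x) B \<partial>L))"

definition ergodic_prob :: "('a::metric_space \<Rightarrow> 'a measure) \<Rightarrow> 'a measure \<Rightarrow> bool" where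
  "ergodic_prob K L \<longleftrightarrow>
     invariant_prob K L \<and>
     (\<forall>f :: 'a \<Rightarrow> real. f \<in> borel_measurable borel \<longrightarrow> bounded (range f) \<longrightarrow>
        (AE x in L. (\<integral> y. f y \<partial>K x) = f x) \<longrightarrow> (\<exists>c. AE x in L. f x = c))"

text \<open>The Frechet function may be infinite, so it takes values in \<^typ>\<open>ennreal\<close>.\<close>

definition frechet_fun :: "'a::metric_space measure \<Rightarrow> 'a \<Rightarrow> ennreal" where
  "frechet_fun L p = (\<integral>\<^sup>+ x. ennreal ((dist x p)\<^sup>2) \<partial>L)"

definition sample_frechet_fun :: "(nat \<Rightarrow> 'w \<Rightarrow> 'a::metric_space) \<Rightarrow> nat \<Rightarrow> 'w \<Rightarrow> 'a \<Rightarrow> real" where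
  "sample_frechet_fun X n w p = (1 / real n) * (\<Sum>k<n. (dist (X k w) p)\<^sup>2)"

definition minimisers :: "('a \<Rightarrow> 'b::linorder) \<Rightarrow> 'a set" where
  "minimisers f = {p. is_arg_min f (\<lambda>_. True) p}"

text \<open>
  \<open>excess S T\<close> is the supremum over \<open>q \<in> S\<close> of the distance from \<open>q\<close> to \<open>T\<close>. It is taken in
  \<^typ>\<open>ennreal\<close>, where an empty infimum is infinite and unbounded suprema are infinite;
  \<^const>\<open>infdist\<close> would give distance 0 to the empty set, and the supremum of an unbounded
  set of reals is unspecified.
\<close>

definition excess :: "'a::metric_space set \<Rightarrow> 'a set \<Rightarrow> ennreal" where
  "excess S T = (SUP q\<in>S. INF y\<in>T. ennreal (dist q y))"

end

theory Submission
  imports Defs "HOL-Library.Discrete_Functions"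
begin

text \<open>
  By the triangle inequality \<open>(dist p q)\<^sup>2 \<le> 2 * F p + 2 * F q\<close> holds both for the Frechet function
  and for its empirical versions, so all minimisers lie in one compact ball; there the empirical
  functions are eventually equi-Lipschitz, and convergence on a countable dense set is uniform.

  Convergence at a point is the ergodic theorem for the integrable function \<open>x \<mapsto> (dist x p)\<^sup>2\<close>. No
  shift space is needed: by a mean ergodic argument in \<open>L\<^sup>2\<close> every integrable function is, up to
  its mean and a small \<open>L\<^sup>1\<close> error, of the form \<open>h - K h\<close> with \<open>h\<close> bounded. Averages of \<open>h - K h\<close>
  along the chain vanish by an orthogonality estimate, and the error is controlled by the maximal
  inequality.
\<close>

section \<open>Mean ergodic approximation by coboundaries\<close>

text \<open>Ergodicity speaks of exactly harmonic, bounded, everywhere defined functions, so near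
  invariance yields nothing by itself: a pointwise limit has to be built. This is why
  \<open>L\<^sup>2\<close> estimates are turned into almost everywhere convergence at a prescribed
  rate and uniform bounds are carried along. Coboundaries suit a chain because their sum is a
  martingale for the given filtration plus a telescoping remainder. Closeness in
  \<open>L\<^sup>1\<close> alone would give only convergence in mean; the maximal inequality bounds
  the averages of the error for all times at once, outside a small event. On the geometric side, the
  Lipschitz constant of a sample function on a ball depends on the sample only through its value at
  one fixed centre, and this value converges. The random sets of minimisers enter path by path: the
  conclusion is deduced for each single \<open>w\<close> from countably many convergences, so
  measurability of these sets is never at issue.\<close>

lemma AE_summable_if_summable_integral:
  fixes u :: "nat \<Rightarrow> 'w \<Rightarrow> real"
  assumes int: "\<And>k. integrable M (u k)" and nonneg: "\<And>k x. 0 \<le> u k x"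
    and sum: "summable (\<lambda>k. \<integral>x. u k x \<partial>M)"
  shows "AE x in M. summable (\<lambda>k. u k x)"
proof -
  have [measurable]: "u k \<in> borel_measurable M" for k using int by auto
  have "(\<integral>\<^sup>+x. (\<Sum>k. ennreal (u k x)) \<partial>M) = (\<Sum>k. \<integral>\<^sup>+x. ennreal (u k x) \<partial>M)"
    by (rule nn_integral_suminf) simp
  also have "\<dots> = (\<Sum>k. ennreal (\<integral>x. u k x \<partial>M))"
    by (intro suminf_cong nn_integral_eq_integral int AE_I2 nonneg)
  also have "\<dots> = ennreal (\<Sum>k. \<integral>x. u k x \<partial>M)"
    by (intro suminf_ennreal2 sum Bochner_Integration.integral_nonneg nonneg)
  finally have "(\<integral>\<^sup>+x. (\<Sum>k. ennreal (u k x)) \<partial>M) \<noteq> \<infinity>" by simp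
  then have "AE x in M. (\<Sum>k. ennreal (u k x)) \<noteq> \<infinity>"
    by (rule nn_integral_PInf_AE[rotated]) simp
  then show ?thesis
    by eventually_elim (rule summable_suminf_not_top, use nonneg in auto)
qed

text \<open>The inequality of arithmetic and geometric means with weight \<open>2 ^ k\<close>; its
  price \<open>(1/2) ^ k\<close> is summable. Fast decay of \<open>L\<^sup>2\<close> distances thus
  yields absolutely summable increments.\<close>

lemma summable_if_weighted_squares:
  fixes u :: "nat \<Rightarrow> real"
  assumes "summable (\<lambda>k. 2 ^ k * (u k)\<^sup>2)"
  shows "summable (\<lambda>k. \<bar>u k\<bar>)"
proof (rule summable_comparison_test')
  show "summable (\<lambda>k. 2 ^ k * (u k)\<^sup>2 + (1/2) ^ k)"
    by (intro summable_add assms summable_geometric) auto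
  fix k :: nat
  have "0 \<le> (2 ^ k * \<bar>u k\<bar> - 1)\<^sup>2 / 2 ^ k" by simp
  also have "\<dots> = 2 ^ k * (u k)\<^sup>2 - 2 * \<bar>u k\<bar> + (1/2) ^ k"
    by (simp add: power2_diff field_simps power2_eq_square abs_mult_self)
  finally show "norm \<bar>u k\<bar> \<le> 2 ^ k * (u k)\<^sup>2 + (1/2) ^ k" by simp
qed

locale ergodic_kernel =
  fixes K :: "'a::metric_space \<Rightarrow> 'a measure" and L :: "'a measure"
  assumes kernel: "markov_kernel K" and ergodic: "ergodic_prob K L"
begin

sublocale L: prob_space L
  using ergodic by (simp add: ergodic_prob_def invariant_prob_def)

lemma sets_L [measurable_cong, simp]: "sets L = sets borel"
  using ergodic by (simp add: ergodic_prob_def invariant_prob_def)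

lemma space_L [simp]: "space L = UNIV"
  using sets_eq_imp_space_eq[OF sets_L] by simp

lemma prob_L_UNIV [simp]: "measure L UNIV = 1"
  using L.prob_space by simp

lemma K_prob_algebra [measurable]: "K \<in> borel \<rightarrow>\<^sub>M prob_algebra borel"
  using kernel by (simp add: markov_kernel_def)

lemma K_subprob_algebra [measurable]: "K \<in> borel \<rightarrow>\<^sub>M subprob_algebra borel"
  by (rule measurable_prob_algebraD) (rule K_prob_algebra)

lemma prob_space_K: "prob_space (K x)" and sets_K [measurable_cong, simp]: "sets (K x) = sets borel"
  using measurable_space[OF K_prob_algebra, of x] by (auto simp: space_prob_algebra)

lemma space_K [simp]: "space (K x) = UNIV"
  using sets_eq_imp_space_eq[OF sets_K] by simp

lemma emeasure_le_1: "emeasure (K x) A \<le> 1"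
proof -
  interpret K: prob_space "K x" by (rule prob_space_K)
  show ?thesis by (rule K.emeasure_le_1)
qed

text \<open>Invariance as an equality in the Giry monad: integrals and null sets then pass through
  the kernel by the general rules for \<open>bind\<close>.\<close>

lemma bind_K: "L \<bind> K = L"
proof (rule measure_eqI)
  show "sets (L \<bind> K) = sets L"
    by (simp add: sets_bind[of _ _ borel])
  fix B assume "B \<in> sets (L \<bind> K)"
  then have B: "B \<in> sets borel" by (simp add: sets_bind[of _ _ borel])
  have "K \<in> L \<rightarrow>\<^sub>M subprob_algebra borel" by measurable
  then show "emeasure (L \<bind> K) B = emeasure L B"
    using B ergodic by (subst emeasure_bind[where N=borel]) (auto simp: ergodic_prob_def invariant_prob_def)
qed

section \<open>The transition operator on bounded measurable functions\<close>

definition kop :: "('a \<Rightarrow> real) \<Rightarrow> 'a \<Rightarrow> real" where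
  "kop h x = (\<integral>y. h y \<partial>K x)"

text \<open>The bound holds at every point and not only almost everywhere, so it survives
  \<open>kop\<close> pointwise and applies along every path of the chain.\<close>

definition bdd_meas :: "real \<Rightarrow> ('a \<Rightarrow> real) set" where
  "bdd_meas B = {h \<in> borel_measurable borel. \<forall>x. \<bar>h x\<bar> \<le> B}"

lemma bdd_measD: "h \<in> bdd_meas B \<Longrightarrow> h \<in> borel_measurable borel" "h \<in> bdd_meas B \<Longrightarrow> \<bar>h x\<bar> \<le> B"
  by (auto simp: bdd_meas_def)

lemma integrable_bdd_K: "h \<in> bdd_meas B \<Longrightarrow> integrable (K x) h"
  using prob_space_K[of x]
  by (intro finite_measure.integrable_const_bound[where B=B])
     (auto simp: bdd_meas_def prob_space_def)

lemma integrable_bdd_L: "h \<in> bdd_meas B \<Longrightarrow> integrable L h"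
  by (intro L.integrable_const_bound[where B=B]) (auto simp: bdd_meas_def)

lemma kop_bdd_meas:
  assumes h: "h \<in> bdd_meas B" shows "kop h \<in> bdd_meas B"
proof -
  have [measurable]: "h \<in> borel_measurable borel" using h by (auto simp: bdd_meas_def)
  interpret K: prob_space "K x" for x by (rule prob_space_K)
  have "\<bar>kop h x\<bar> \<le> B" for x
  proof -
    have "\<bar>kop h x\<bar> \<le> (\<integral>y. \<bar>h y\<bar> \<partial>K x)" unfolding kop_def by (rule integral_abs_bound)
    also have "\<dots> \<le> (\<integral>y. B \<partial>K x)"
      using integrable_bdd_K[OF h] by (intro integral_mono integrable_abs) (auto simp: bdd_measD[OF h])
    finally show ?thesis using K.prob_space by simp
  qed
  moreover have "kop h \<in> borel_measurable borel" unfolding kop_def[abs_def] by measurable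
  ultimately show ?thesis by (auto simp: bdd_meas_def)
qed

lemma kop_lin:
  assumes "g \<in> bdd_meas B" "h \<in> bdd_meas C"
  shows "kop (\<lambda>x. a * g x + b * h x) x = a * kop g x + b * kop h x"
  using integrable_bdd_K[OF assms(1)] integrable_bdd_K[OF assms(2)] by (simp add: kop_def)

lemma bdd_meas_lin:
  assumes "g \<in> bdd_meas B" "h \<in> bdd_meas C"
  shows "(\<lambda>x. a * g x + b * h x) \<in> bdd_meas (\<bar>a\<bar> * B + \<bar>b\<bar> * C)"
proof -
  have [measurable]: "g \<in> borel_measurable borel" "h \<in> borel_measurable borel"
    using assms by (auto simp: bdd_meas_def)
  have "\<bar>a * g x + b * h x\<bar> \<le> \<bar>a\<bar> * B + \<bar>b\<bar> * C" for x
    using mult_left_mono[OF bdd_measD(2)[OF assms(1)], of "\<bar>a\<bar>" x]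
      mult_left_mono[OF bdd_measD(2)[OF assms(2)], of "\<bar>b\<bar>" x]
    by (simp flip: abs_mult)
  then show ?thesis by (simp add: bdd_meas_def)
qed

lemma bdd_meas_power2:
  assumes "h \<in> bdd_meas B" shows "(\<lambda>x. (h x)\<^sup>2) \<in> bdd_meas (B\<^sup>2)"
  using assms by (auto simp: bdd_meas_def abs_le_square_iff intro!: borel_measurable_power)
    (metis abs_ge_zero order_trans power2_abs power_mono)

lemma integral_kop:
  assumes h: "h \<in> bdd_meas B" shows "(\<integral>x. kop h x \<partial>L) = (\<integral>x. h x \<partial>L)"
proof -
  have "(\<integral>x. h x \<partial>(L \<bind> K)) = (\<integral>x. kop h x \<partial>L)"
    unfolding kop_def using bdd_measD[OF h]
    by (intro integral_bind[where B'=1 and B=B])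
       (auto simp: emeasure_le_1)
  then show ?thesis by (simp add: bind_K)
qed

text \<open>Jensen's inequality in its simplest case: the variance of \<open>h\<close> under
  \<open>K x\<close> is nonnegative.\<close>

lemma kop_power2_le:
  assumes h: "h \<in> bdd_meas B" shows "(kop h x)\<^sup>2 \<le> kop (\<lambda>x. (h x)\<^sup>2) x"
proof -
  interpret K: prob_space "K x" by (rule prob_space_K)
  show ?thesis
    using K.variance_eq[OF integrable_bdd_K[OF h] integrable_bdd_K[OF bdd_meas_power2[OF h]]]
      K.variance_positive[of h] by (simp add: kop_def)
qed

text \<open>By invariance an \<open>L\<close>-null set is null for almost every \<open>K x\<close>.
  This allows limits to be taken under the kernel.\<close>

lemma AE_K:
  assumes [measurable]: "Measurable.pred borel Q" and "AE x in L. Q x"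
  shows "AE x in L. AE y in K x. Q y"
proof -
  have "AE x in L \<bind> K. Q x" unfolding bind_K by (rule assms(2))
  then show ?thesis by (subst (asm) AE_bind[where B=borel]) auto
qed

text \<open>
  The set \<open>cohomologous f B\<close> is convex and invariant under the kernel operator. An element of
  nearly minimal \<open>L\<^sup>2\<close> norm is nearly invariant by the parallelogram law, hence nearly constant.
\<close>

definition cohomologous :: "('a \<Rightarrow> real) \<Rightarrow> real \<Rightarrow> ('a \<Rightarrow> real) set" where
  "cohomologous f B = {g \<in> bdd_meas B. \<exists>C. \<exists>h\<in>bdd_meas C. \<forall>x. f x - g x = h x - kop h x}"

lemma cohomologous_self: "f \<in> bdd_meas B \<Longrightarrow> f \<in> cohomologous f B"
  unfolding cohomologous_def
  by (auto simp: kop_def intro!: exI[of _ 0] bexI[of _ "\<lambda>_. 0"]) (auto simp: bdd_meas_def)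

lemma cohomologous_mid:
  assumes "g \<in> cohomologous f B" "g' \<in> cohomologous f B"
  shows "(\<lambda>x. (1/2) * g x + (1/2) * g' x) \<in> cohomologous f B"
proof -
  obtain C h C' h' where h: "h \<in> bdd_meas C" "h' \<in> bdd_meas C'"
    and eq: "\<And>x. f x - g x = h x - kop h x" "\<And>x. f x - g' x = h' x - kop h' x"
    and g: "g \<in> bdd_meas B" "g' \<in> bdd_meas B"
    using assms unfolding cohomologous_def by blast
  have "f x - ((1/2) * g x + (1/2) * g' x) =
      ((1/2) * h x + (1/2) * h' x) - kop (\<lambda>x. (1/2) * h x + (1/2) * h' x) x" for x
    unfolding kop_lin[OF h] using eq[of x] by (simp add: field_simps)
  then show ?thesis using bdd_meas_lin[OF g, of "1/2" "1/2"] bdd_meas_lin[OF h, of "1/2" "1/2"]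
    by (auto simp: cohomologous_def)
qed

text \<open>Since \<open>f - K g = (f - g) + (g - K g)\<close>, the function \<open>g\<close> itself
  is added to the transfer function \<open>h\<close>. The bound on transfer functions may grow; only
  the bound \<open>B\<close> on the class is kept.\<close>

lemma cohomologous_kop:
  assumes "g \<in> cohomologous f B" shows "kop g \<in> cohomologous f B"
proof -
  obtain C h where h: "h \<in> bdd_meas C" and eq: "\<And>x. f x - g x = h x - kop h x"
    and g: "g \<in> bdd_meas B" using assms unfolding cohomologous_def by blast
  have "f x - kop g x = (1 * h x + 1 * g x) - kop (\<lambda>x. 1 * h x + 1 * g x) x" for x
    unfolding kop_lin[OF h g] using eq[of x] by simp
  with bdd_meas_lin[OF h g, of 1 1] kop_bdd_meas[OF g] show ?thesis unfolding cohomologous_def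
    by (intro CollectI conjI exI[of _ "\<bar>1\<bar> * C + \<bar>1\<bar> * B"] bexI[of _ "\<lambda>x. 1 * h x + 1 * g x"] allI)
qed

section \<open>Nearly minimal elements in the \<open>L\<^sup>2\<close> norm\<close>

definition sqn :: "('a \<Rightarrow> real) \<Rightarrow> real" where "sqn g = (\<integral>x. (g x)\<^sup>2 \<partial>L)"

lemma sqn_nonneg: "0 \<le> sqn g" by (simp add: sqn_def)

lemma sqn_kop: assumes "g \<in> bdd_meas B" shows "sqn (kop g) \<le> sqn g"
proof -
  note sq = bdd_meas_power2[OF assms]
  have "sqn (kop g) \<le> (\<integral>x. kop (\<lambda>x. (g x)\<^sup>2) x \<partial>L)" unfolding sqn_def
    by (intro integral_mono integrable_bdd_L[OF bdd_meas_power2[OF kop_bdd_meas[OF assms]]]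
      integrable_bdd_L[OF kop_bdd_meas[OF sq]] kop_power2_le[OF assms])
  then show ?thesis by (simp add: integral_kop[OF sq] sqn_def)
qed

lemma parallelogram:
  assumes g: "g \<in> bdd_meas B" "h \<in> bdd_meas C"
  shows "sqn (\<lambda>x. g x - h x) = 2 * sqn g + 2 * sqn h - 4 * sqn (\<lambda>x. (1/2) * g x + (1/2) * h x)"
proof -
  have [simp]: "integrable L (\<lambda>x. (g x)\<^sup>2)" "integrable L (\<lambda>x. (h x)\<^sup>2)"
    "integrable L (\<lambda>x. ((1/2) * g x + (1/2) * h x)\<^sup>2)"
    by (rule integrable_bdd_L bdd_meas_power2 g bdd_meas_lin)+
  then have [simp]: "integrable L (\<lambda>x. (g x / 2 + h x / 2)\<^sup>2)" by simp
  have "sqn (\<lambda>x. g x - h x)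
      = (\<integral>x. 2 * (g x)\<^sup>2 + 2 * (h x)\<^sup>2 - 4 * ((1/2) * g x + (1/2) * h x)\<^sup>2 \<partial>L)"
    unfolding sqn_def by (intro Bochner_Integration.integral_cong) (auto simp: power2_eq_square field_simps)
  also have "\<dots> = 2 * sqn g + 2 * sqn h - 4 * sqn (\<lambda>x. (1/2) * g x + (1/2) * h x)"
    unfolding sqn_def by (subst Bochner_Integration.integral_diff) simp_all
  finally show ?thesis .
qed

text \<open>The midpoint lies in the class and so has squared norm at least \<open>d\<close>; the
  parallelogram law leaves \<open>2 * (d + e) + 2 * (d + e) - 4 * d\<close>.\<close>

lemma near_minimal_close:
  assumes "g \<in> cohomologous f B" "g' \<in> cohomologous f B" and low: "\<And>h. h \<in> cohomologous f B \<Longrightarrow> d \<le> sqn h"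
    and "sqn g \<le> d + e" "sqn g' \<le> d + e"
  shows "sqn (\<lambda>x. g x - g' x) \<le> 4 * e"
proof -
  have "g \<in> bdd_meas B" "g' \<in> bdd_meas B" using assms by (auto simp: cohomologous_def)
  from parallelogram[OF this] low[OF cohomologous_mid[OF assms(1,2)]] assms(4,5) show ?thesis by linarith
qed

lemma integrable_sq_diff:
  assumes "g \<in> bdd_meas B" "h \<in> bdd_meas C" shows "integrable L (\<lambda>x. (g x - h x)\<^sup>2)"
  using integrable_bdd_L[OF bdd_meas_power2[OF bdd_meas_lin[OF assms, of 1 "-1"]]] by simp

text \<open>The rate \<open>(1/16) ^ m\<close> absorbs the weight \<open>2 ^ m\<close> of the square
  criterion and leaves a geometric series of ratio \<open>1/8\<close>.\<close>

lemma AE_summable_fast: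
  assumes g: "\<And>m. g m \<in> bdd_meas B" "\<And>m. h m \<in> bdd_meas B"
    and le: "\<And>m. sqn (\<lambda>x. g m x - h m x) \<le> 4 * (1/16) ^ m"
  shows "AE x in L. summable (\<lambda>m. \<bar>g m x - h m x\<bar>)"
proof -
  have "AE x in L. summable (\<lambda>m. 2 ^ m * (g m x - h m x)\<^sup>2)"
  proof (rule AE_summable_if_summable_integral)
    show "integrable L (\<lambda>x. 2 ^ m * (g m x - h m x)\<^sup>2)" for m
      using integrable_sq_diff[OF g] by simp
    show "summable (\<lambda>m. \<integral>x. 2 ^ m * (g m x - h m x)\<^sup>2 \<partial>L)"
    proof (rule summable_comparison_test')
      show "summable (\<lambda>m. 4 * (1/8::real) ^ m)" by (intro summable_mult summable_geometric) auto
      fix m :: nat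
      have "(\<integral>x. 2 ^ m * (g m x - h m x)\<^sup>2 \<partial>L) = 2 ^ m * sqn (\<lambda>x. g m x - h m x)"
        by (simp add: sqn_def)
      also have "\<dots> \<le> 2 ^ m * (4 * (1/16) ^ m)" by (intro mult_left_mono le) simp
      also have "\<dots> = 4 * (1/8) ^ m" by (simp flip: power_mult_distrib)
      finally show "norm (\<integral>x. 2 ^ m * (g m x - h m x)\<^sup>2 \<partial>L) \<le> 4 * (1/8) ^ m"
        by simp
    qed
  qed auto
  then show ?thesis by eventually_elim (rule summable_if_weighted_squares)
qed

text \<open>A minimising sequence with geometric rate converges almost everywhere, so its limit can
  be formed without any compactness or completeness of \<open>L\<^sup>2\<close>. The limit is
  harmonic, ergodicity makes it constant, and dominated convergence returns to a member of the
  sequence.\<close>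

lemma mean_ergodic_bounded:
  assumes f: "f \<in> bdd_meas B" and "0 < e"
  shows "\<exists>g\<in>cohomologous f B. \<exists>c. (\<integral>x. \<bar>g x - c\<bar> \<partial>L) < e"
proof -
  define d where "d = Inf (sqn ` cohomologous f B)"
  have bdd: "bdd_below (sqn ` cohomologous f B)" using sqn_nonneg by (intro bdd_belowI[of _ 0]) auto
  have low: "d \<le> sqn h" if "h \<in> cohomologous f B" for h
    unfolding d_def using bdd that by (intro cInf_lower) auto
  have "\<exists>g\<in>cohomologous f B. sqn g \<le> d + (1/16) ^ m" for m :: nat
  proof -
    have "Inf (sqn ` cohomologous f B) < d + (1/16) ^ m" by (simp add: d_def)
    then show ?thesis
      by (subst (asm) cInf_less_iff) (use bdd cohomologous_self[OF f] in \<open>auto intro: less_imp_le\<close>)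
  qed
  then obtain g where gc: "\<And>m. g m \<in> cohomologous f B" and gle: "\<And>m. sqn (g m) \<le> d + (1/16) ^ m" by metis
  have gb: "g m \<in> bdd_meas B" for m using gc by (auto simp: cohomologous_def)
  have gm [measurable]: "g m \<in> borel_measurable borel" for m by (rule bdd_measD(1)[OF gb])
  have "AE x in L. summable (\<lambda>m. \<bar>g (Suc m) x - g m x\<bar>)"
  proof (rule AE_summable_fast[OF gb gb])
    fix m :: nat
    have "sqn (g (Suc m)) \<le> d + (1/16) ^ m" using gle[of "Suc m"] power_decreasing[of m "Suc m" "1/16::real"]
      by (intro order_trans[OF gle[of "Suc m"]] add_left_mono power_decreasing) auto
    from near_minimal_close[OF gc gc low this gle] show "sqn (\<lambda>x. g (Suc m) x - g m x) \<le> 4 * (1/16) ^ m" .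
  qed
  then have conv: "AE x in L. convergent (\<lambda>m. g m x)"
  proof eventually_elim
    fix x assume "summable (\<lambda>m. \<bar>g (Suc m) x - g m x\<bar>)"
    then have "summable (\<lambda>m. g (Suc m) x - g m x)" by (rule summable_rabs_cancel)
    then show "convergent (\<lambda>m. g m x)"
      by (simp only: summable_iff_convergent sum_lessThan_telescope[of "\<lambda>m. g m x"] convergent_diff_const_right_iff)
  qed
  have kconv: "AE x in L. (\<lambda>m. kop (g m) x - g m x) \<longlonglongrightarrow> 0"
  proof -
    have "AE x in L. summable (\<lambda>m. \<bar>kop (g m) x - g m x\<bar>)"
    \<comment> \<open>As a contraction, \<open>kop\<close> maps \<open>g m\<close> to another
      element of the class that is just as close to minimal; the two must therefore be close to each
      other.\<close>
    proof (rule AE_summable_fast[OF kop_bdd_meas[OF gb] gb])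
      fix m :: nat
      have "sqn (kop (g m)) \<le> d + (1/16) ^ m" using sqn_kop[OF gb] gle by (rule order_trans)
      from near_minimal_close[OF cohomologous_kop[OF gc] gc low this gle]
      show "sqn (\<lambda>x. kop (g m) x - g m x) \<le> 4 * (1/16) ^ m" .
    qed
    then show ?thesis
      by eventually_elim (auto dest!: summable_LIMSEQ_zero simp: tendsto_rabs_zero_iff)
  qed
  \<comment> \<open>Where the sequence diverges, \<open>lim\<close> is an unspecified value.
    Clipping gives a function bounded everywhere, as the definition of ergodicity demands, and
    changes nothing where the sequence converges.\<close>
  define G where "G x = max (-B) (min B (lim (\<lambda>m. g m x)))" for x
  have [measurable]: "G \<in> borel_measurable borel" unfolding G_def by measurable
  have lim: "(\<lambda>m. g m x) \<longlonglongrightarrow> G x" if "convergent (\<lambda>m. g m x)" for x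
  proof -
    have l: "(\<lambda>m. g m x) \<longlonglongrightarrow> lim (\<lambda>m. g m x)" using that by (simp add: convergent_LIMSEQ_iff)
    have "\<bar>lim (\<lambda>m. g m x)\<bar> \<le> B"
      by (rule LIMSEQ_le_const2[OF tendsto_rabs[OF l]]) (auto simp: bdd_measD[OF gb])
    then have "G x = lim (\<lambda>m. g m x)" unfolding G_def by linarith
    with l show ?thesis by simp
  qed
  \<comment> \<open>Here \<open>undefined\<close> merely names some point of the nonempty state
    space.\<close>
  have "0 \<le> B" using bdd_measD(2)[OF f, of undefined] by linarith
  then have Gb: "G \<in> bdd_meas B" by (auto simp: bdd_meas_def) (auto simp: G_def)
  have limG: "AE x in L. (\<lambda>m. g m x) \<longlonglongrightarrow> G x" using conv by eventually_elim (rule lim)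
  \<comment> \<open>Dominated convergence for \<open>kop (g m) x\<close> takes place under
    \<open>K x\<close>, hence the convergence has to hold almost everywhere for \<open>K x\<close>
    too.\<close>
  then have "AE x in L. AE y in K x. (\<lambda>m. g m y) \<longlonglongrightarrow> G y"
    by (rule AE_K[rotated]) measurable
  then have "AE x in L. (\<lambda>m. kop (g m) x) \<longlonglongrightarrow> kop G x"
  proof eventually_elim
    fix x assume *: "AE y in K x. (\<lambda>m. g m y) \<longlonglongrightarrow> G y"
    interpret K: prob_space "K x" by (rule prob_space_K)
    show "(\<lambda>m. kop (g m) x) \<longlonglongrightarrow> kop G x" unfolding kop_def
      by (rule integral_dominated_convergence[where w="\<lambda>_. B"]) (use * bdd_measD[OF gb] in auto)
  qed
  with kconv limG have "AE x in L. kop G x = G x"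
  proof eventually_elim
    fix x assume a: "(\<lambda>m. kop (g m) x - g m x) \<longlonglongrightarrow> 0" "(\<lambda>m. g m x) \<longlonglongrightarrow> G x" "(\<lambda>m. kop (g m) x) \<longlonglongrightarrow> kop G x"
    from LIMSEQ_unique[OF a(1) tendsto_diff[OF a(3,2)]] show "kop G x = G x" by simp
  qed
  moreover have "bounded (range G)" using bdd_measD[OF Gb] by (auto simp: bounded_iff)
  ultimately obtain c where c: "AE x in L. G x = c"
    using ergodic unfolding ergodic_prob_def kop_def by (metis \<open>G \<in> borel_measurable borel\<close>)
  have "(\<lambda>m. \<integral>x. \<bar>g m x - c\<bar> \<partial>L) \<longlonglongrightarrow> (\<integral>x. 0 \<partial>L)"
  proof (rule integral_dominated_convergence[where w="\<lambda>_. B + \<bar>c\<bar>"])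
    show "AE x in L. (\<lambda>m. \<bar>g m x - c\<bar>) \<longlonglongrightarrow> 0" using limG c
      by eventually_elim (auto intro!: tendsto_rabs_zero simp: LIM_zero)
    show "AE x in L. norm \<bar>g m x - c\<bar> \<le> B + \<bar>c\<bar>" for m
    proof (rule AE_I2)
      fix x show "norm \<bar>g m x - c\<bar> \<le> B + \<bar>c\<bar>" using bdd_measD(2)[OF gb, of m x] by simp
    qed
  qed auto
  then have "eventually (\<lambda>m. (\<integral>x. \<bar>g m x - c\<bar> \<partial>L) < e) sequentially"
    using \<open>0 < e\<close> by (auto dest: order_tendstoD)
  then obtain m where "(\<integral>x. \<bar>g m x - c\<bar> \<partial>L) < e" using eventually_happens by fastforce
  with gc show ?thesis by blast
qed

text \<open>Truncation reduces to the bounded case. The error splits into the truncation error, the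
  distance of \<open>g\<close> from the constant \<open>c\<close>, and the distance of
  \<open>c\<close> from the mean; the first two together stay below \<open>e/2\<close>, the third is
  at most \<open>e/2\<close>.\<close>

lemma coboundary_approx:
  assumes f: "integrable L f" and "0 < e"
  shows "\<exists>B. \<exists>h\<in>bdd_meas B. (\<integral>x. \<bar>f x - (\<integral>x. f x \<partial>L) - (h x - kop h x)\<bar> \<partial>L) < e"
proof -
  have [measurable]: "f \<in> borel_measurable borel" using f by (simp cong: measurable_cong_sets)
  define ft where "ft N x = max (- real N) (min (real N) (f x))" for N :: nat and x
  have [measurable]: "ft N \<in> borel_measurable borel" for N unfolding ft_def by measurable
  have ftb: "ft N \<in> bdd_meas (real N)" for N by (auto simp: bdd_meas_def) (auto simp: ft_def)
  have "(\<lambda>N. \<integral>x. \<bar>f x - ft N x\<bar> \<partial>L) \<longlonglongrightarrow> (\<integral>x. 0 \<partial>L)"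
  proof (rule integral_dominated_convergence[where w="\<lambda>x. \<bar>f x\<bar>"])
    show "AE x in L. (\<lambda>N. \<bar>f x - ft N x\<bar>) \<longlonglongrightarrow> 0"
    proof (rule AE_I2)
      fix x
      obtain N0 :: nat where "\<bar>f x\<bar> \<le> real N0" using real_arch_simple by blast
      then have "\<forall>N\<ge>N0. \<bar>f x - ft N x\<bar> = 0" by (auto simp: ft_def)
      then show "(\<lambda>N. \<bar>f x - ft N x\<bar>) \<longlonglongrightarrow> 0"
        by (intro tendsto_eventually) (auto simp: eventually_sequentially)
    qed
    show "AE x in L. norm \<bar>f x - ft N x\<bar> \<le> \<bar>f x\<bar>" for N by (rule AE_I2) (auto simp: ft_def)
  qed (use f in auto)
  then have "eventually (\<lambda>N. (\<integral>x. \<bar>f x - ft N x\<bar> \<partial>L) < e/4) sequentially"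
    using \<open>0 < e\<close> by (intro order_tendstoD(2)[where y="\<integral>x. 0 \<partial>L"]) auto
  then obtain N where N: "(\<integral>x. \<bar>f x - ft N x\<bar> \<partial>L) < e/4" using eventually_happens by fastforce
  obtain g c where g: "g \<in> cohomologous (ft N) (real N)" and gc: "(\<integral>x. \<bar>g x - c\<bar> \<partial>L) < e/4"
    using mean_ergodic_bounded[OF ftb, of "e/4" N] \<open>0 < e\<close> by auto
  then obtain C h where h: "h \<in> bdd_meas C" and eq: "\<And>x. ft N x - g x = h x - kop h x"
    and gb: "g \<in> bdd_meas (real N)" unfolding cohomologous_def by blast
  note [simp] = integrable_bdd_L[OF ftb] integrable_bdd_L[OF gb] integrable_bdd_L[OF h]
    integrable_bdd_L[OF kop_bdd_meas[OF h]] f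
  let ?r = "\<lambda>x. (f x - ft N x) + (g x - c)"
  have int_abs: "(\<integral>x. \<bar>?r x\<bar> \<partial>L) < e/2"
  proof -
    have "(\<integral>x. \<bar>?r x\<bar> \<partial>L) \<le> (\<integral>x. \<bar>f x - ft N x\<bar> + \<bar>g x - c\<bar> \<partial>L)"
      by (intro integral_mono) auto
    also have "\<dots> < e/2" using N gc by simp
    finally show ?thesis .
  qed
  \<comment> \<open>Integration identifies \<open>c\<close> up to the error already controlled,
    because a coboundary has mean zero under an invariant measure.\<close>
  have "(\<integral>x. ?r x \<partial>L) = (\<integral>x. (f x - c) - (h x - kop h x) \<partial>L)"
    using eq by (intro Bochner_Integration.integral_cong) (auto simp: algebra_simps)
  also have "\<dots> = (\<integral>x. f x \<partial>L) - c" by (simp add: integral_kop[OF h] L.prob_space)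
  finally have cc: "\<bar>(\<integral>x. f x \<partial>L) - c\<bar> \<le> e/2"
    using integral_abs_bound[of L ?r] int_abs by simp
  have "(\<integral>x. \<bar>f x - (\<integral>x. f x \<partial>L) - (h x - kop h x)\<bar> \<partial>L) \<le> (\<integral>x. \<bar>?r x\<bar> + \<bar>(\<integral>x. f x \<partial>L) - c\<bar> \<partial>L)"
    by (intro integral_mono) (use eq in \<open>auto simp flip: eq\<close>)
  also have "\<dots> = (\<integral>x. \<bar>?r x\<bar> \<partial>L) + \<bar>(\<integral>x. f x \<partial>L) - c\<bar>" by (simp add: L.prob_space)
  also have "\<dots> < e" using int_abs cc by linarith
  finally show ?thesis using h by blast
qed

end

section \<open>Stationarity of the chain\<close>

locale stationary_chain = ergodic_kernel K L
  for K :: "'a::metric_space \<Rightarrow> 'a measure" and L :: "'a measure" +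
  fixes P :: "'w measure" and A :: "nat \<Rightarrow> 'w measure" and X :: "nat \<Rightarrow> 'w \<Rightarrow> 'a"
  assumes chain: "markov_chain P A K X" and initial: "distr P borel (X 0) = L"
begin

sublocale P: prob_space P
  using chain by (simp add: markov_chain_def)

lemma subalgebra_A: "subalgebra P (A n)"
  using chain by (simp add: markov_chain_def)

lemma sigma_finite_A: "sigma_finite_subalgebra P (A n)"
  by (intro finite_measure_subalgebra_is_sigma_finite finite_measure_subalgebra.intro
      finite_measure_subalgebra_axioms.intro subalgebra_A P.finite_measure_axioms)

lemma space_A [simp]: "space (A n) = space P"
  using subalgebra_A by (simp add: subalgebra_def)

lemma sets_A_mono: "m \<le> n \<Longrightarrow> sets (A m) \<subseteq> sets (A n)"
  using chain by (auto simp: markov_chain_def filtration_def)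

lemma sets_A_le: "S \<in> sets (A n) \<Longrightarrow> S \<in> sets P"
  using subalgebra_A by (auto simp: subalgebra_def)

lemma X_adapted: "m \<le> n \<Longrightarrow> X m \<in> A n \<rightarrow>\<^sub>M borel"
  using chain measurable_mono[of borel borel "A m" "A n"] sets_A_mono[of m n]
  by (auto simp: markov_chain_def)

lemma X_measurable [measurable]: "X n \<in> P \<rightarrow>\<^sub>M borel"
  by (rule measurable_from_subalg[OF subalgebra_A X_adapted[of n n]]) simp

lemma adapted_measurable: "Z \<in> borel_measurable (A n) \<Longrightarrow> Z \<in> borel_measurable P"
  by (rule measurable_from_subalg[OF subalgebra_A])

lemma KX_measurable [measurable]: "(\<lambda>w. K (X n w)) \<in> P \<rightarrow>\<^sub>M subprob_algebra borel"
  by (rule measurable_compose[OF X_measurable K_subprob_algebra])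

section \<open>The Markov property on events of the past\<close>

lemma markov_emeasure:
  assumes S: "S \<in> sets (A n)" and [measurable]: "B \<in> sets borel"
  shows "emeasure P (S \<inter> (X (Suc n) -` B \<inter> space P))
    = (\<integral>\<^sup>+w. indicator S w * emeasure (K (X n w)) B \<partial>P)"
proof -
  interpret sigma_finite_subalgebra P "A n" by (rule sigma_finite_A)
  interpret K: prob_space "K x" for x by (rule prob_space_K)
  have [measurable]: "S \<in> sets P" using S by (rule sets_A_le)
  let ?T = "X (Suc n) -` B \<inter> space P"
  have [measurable]: "?T \<in> sets P" by measurable
  have [measurable]: "(\<lambda>w. measure (K (X n w)) B) \<in> borel_measurable P"
    by (rule measurable_compose[OF KX_measurable measurable_measure_subprob_algebra]) simp
  have "measure P (S \<inter> ?T) = (\<integral>w. indicator S w * indicator ?T w \<partial>P)"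
    by (simp flip: indicator_inter_arith)
  also have "\<dots> = (\<integral>w\<in>S. indicator ?T w \<partial>P)"
    by (simp add: set_lebesgue_integral_def)
  also have "\<dots> = (\<integral>w\<in>S. real_cond_exp P (A n) (indicator ?T) w \<partial>P)"
    by (rule real_cond_exp_intA) (use S in \<open>auto simp: P.emeasure_eq_measure\<close>)
  also have "\<dots> = (\<integral>w. indicator S w * measure (K (X n w)) B \<partial>P)"
    unfolding set_lebesgue_integral_def
  proof (rule integral_cong_AE)
    have "AE w in P. real_cond_exp P (A n) (indicator ?T) w = measure (K (X n w)) B"
      using chain assms(2) by (simp add: markov_chain_def)
    then show "AE w in P. indicat_real S w *\<^sub>R real_cond_exp P (A n) (indicator ?T) w
        = indicator S w * measure (K (X n w)) B"
      by eventually_elim simp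
  qed auto
  finally have eq: "measure P (S \<inter> ?T) = (\<integral>w. indicator S w * measure (K (X n w)) B \<partial>P)" .
  have "emeasure P (S \<inter> ?T) = ennreal (\<integral>w. indicator S w * measure (K (X n w)) B \<partial>P)"
    by (simp add: P.emeasure_eq_measure eq)
  also have "\<dots> = (\<integral>\<^sup>+w. ennreal (indicator S w * measure (K (X n w)) B) \<partial>P)"
    by (intro nn_integral_eq_integral[symmetric] P.integrable_const_bound[where B=1] AE_I2)
       (auto simp: indicator_def)
  also have "\<dots> = (\<integral>\<^sup>+w. indicator S w * emeasure (K (X n w)) B \<partial>P)"
    by (intro nn_integral_cong) (auto simp: K.emeasure_eq_measure indicator_def)
  finally show ?thesis .
qed

text \<open>Restricting \<open>P\<close> to \<open>S\<close> by a density turns the Markov property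
  for all \<open>B\<close> into one equality of measures. Test functions other than indicators are
  then handled by the integral rules for \<open>bind\<close>.\<close>

lemma markov_distr:
  assumes S: "S \<in> sets (A n)"
  shows "distr (density P (indicator S)) borel (X (Suc n)) = density P (indicator S) \<bind> (\<lambda>w. K (X n w))"
proof (rule measure_eqI)
  have [measurable]: "S \<in> sets P" using S by (rule sets_A_le)
  have ne: "space (density P (indicator S)) \<noteq> {}" using P.not_empty by simp
  have m: "(\<lambda>w. K (X n w)) \<in> density P (indicator S) \<rightarrow>\<^sub>M subprob_algebra borel" by simp
  show "sets (distr (density P (indicator S)) borel (X (Suc n)))
      = sets (density P (indicator S) \<bind> (\<lambda>w. K (X n w)))"
    using ne by (simp add: sets_bind[of _ _ borel])
  fix B assume "B \<in> sets (distr (density P (indicator S)) borel (X (Suc n)))"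
  then have [measurable]: "B \<in> sets borel" by simp
  have "emeasure (distr (density P (indicator S)) borel (X (Suc n))) B
      = emeasure P (S \<inter> (X (Suc n) -` B \<inter> space P))"
    by (simp add: emeasure_distr emeasure_density flip: indicator_inter_arith)
  also have "\<dots> = (\<integral>\<^sup>+w. indicator S w * emeasure (K (X n w)) B \<partial>P)"
    by (rule markov_emeasure[OF S]) simp
  also have "\<dots> = emeasure (density P (indicator S) \<bind> (\<lambda>w. K (X n w))) B"
    using ne m by (simp add: emeasure_bind[where N=borel] nn_integral_density)
  finally show "emeasure (distr (density P (indicator S)) borel (X (Suc n))) B
      = emeasure (density P (indicator S) \<bind> (\<lambda>w. K (X n w))) B" .
qed

lemma markov_nn_integral:
  assumes S: "S \<in> sets (A n)" and [measurable]: "h \<in> borel_measurable borel"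
  shows "(\<integral>\<^sup>+w. indicator S w * h (X (Suc n) w) \<partial>P)
    = (\<integral>\<^sup>+w. indicator S w * (\<integral>\<^sup>+y. h y \<partial>K (X n w)) \<partial>P)"
proof -
  have [measurable]: "S \<in> sets P" using S by (rule sets_A_le)
  have "(\<integral>\<^sup>+w. indicator S w * h (X (Suc n) w) \<partial>P)
      = (\<integral>\<^sup>+y. h y \<partial>distr (density P (indicator S)) borel (X (Suc n)))"
    by (simp add: nn_integral_distr nn_integral_density)
  also have "\<dots> = (\<integral>\<^sup>+w. (\<integral>\<^sup>+y. h y \<partial>K (X n w)) \<partial>density P (indicator S))"
    unfolding markov_distr[OF S] by (rule nn_integral_bind[where B=borel]) simp_all
  also have "\<dots> = (\<integral>\<^sup>+w. indicator S w * (\<integral>\<^sup>+y. h y \<partial>K (X n w)) \<partial>P)"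
    by (simp add: nn_integral_density)
  finally show ?thesis .
qed

lemma markov_cond_exp:
  assumes h: "h \<in> bdd_meas B"
  shows "AE w in P. real_cond_exp P (A n) (\<lambda>w. h (X (Suc n) w)) w = kop h (X n w)"
proof -
  interpret sigma_finite_subalgebra P "A n" by (rule sigma_finite_A)
  note kh = kop_bdd_meas[OF h]
  have [measurable]: "h \<in> borel_measurable borel" "kop h \<in> borel_measurable borel"
    using h kh by (auto simp: bdd_meas_def)
  show ?thesis
  proof (rule real_cond_exp_charact)
    show "integrable P (\<lambda>w. h (X (Suc n) w))" "integrable P (\<lambda>w. kop h (X n w))"
      using bdd_measD[OF h] bdd_measD[OF kh] by (auto intro!: P.integrable_const_bound[where B=B])
    show "(\<lambda>w. kop h (X n w)) \<in> borel_measurable (A n)"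
      by (rule measurable_compose[OF X_adapted[of n n]]) auto
    fix S assume S: "S \<in> sets (A n)"
    have [measurable]: "S \<in> sets P" using S by (rule sets_A_le)
    have fin: "finite_measure (density P (indicator S))"
      by (rule finite_measureI) (simp add: emeasure_density P.emeasure_eq_measure)
    have "(\<integral>w\<in>S. h (X (Suc n) w) \<partial>P)
        = (\<integral>y. h y \<partial>distr (density P (\<lambda>w. ennreal (indicator S w))) borel (X (Suc n)))"
      by (subst integral_distr, simp, simp, subst integral_density)
         (simp_all add: set_lebesgue_integral_def)
    also have "\<dots> = (\<integral>y. h y \<partial>(density P (indicator S) \<bind> (\<lambda>w. K (X n w))))"
      using markov_distr[OF S] by (simp add: ennreal_indicator)
    also have "\<dots> = (\<integral>w. kop h (X n w) \<partial>density P (\<lambda>w. ennreal (indicator S w)))"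
      unfolding kop_def ennreal_indicator
      by (rule integral_bind[where B'=1 and B=B and K=borel])
         (use bdd_measD[OF h] fin in \<open>auto simp: emeasure_le_1\<close>)
    also have "\<dots> = (\<integral>w\<in>S. kop h (X n w) \<partial>P)"
      by (subst integral_density) (simp_all add: set_lebesgue_integral_def)
    finally show "(\<integral>w\<in>S. h (X (Suc n) w) \<partial>P) = (\<integral>w\<in>S. kop h (X n w) \<partial>P)" .
  qed
qed

section \<open>Stationarity of marginals and of finite windows\<close>

lemma nn_integral_X:
  assumes [measurable]: "h \<in> borel_measurable borel"
  shows "(\<integral>\<^sup>+w. h (X n w) \<partial>P) = (\<integral>\<^sup>+x. h x \<partial>L)"
  using assms
proof (induction n arbitrary: h)
  case 0
  then show ?case using nn_integral_distr[of "X 0" P borel h] initial by simp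
next
  case (Suc n)
  note [measurable] = Suc.prems
  \<comment> \<open>The factor is 1 on the whole space; it brings the integral into the form of the
    Markov property for the event \<open>space P\<close>.\<close>
  have "(\<integral>\<^sup>+w. h (X (Suc n) w) \<partial>P) = (\<integral>\<^sup>+w. indicator (space P) w * h (X (Suc n) w) \<partial>P)"
    by (intro nn_integral_cong) auto
  also have "\<dots> = (\<integral>\<^sup>+w. indicator (space P) w * (\<integral>\<^sup>+y. h y \<partial>K (X n w)) \<partial>P)"
    by (rule markov_nn_integral) (use sets.top[of "A n"] in auto)
  also have "\<dots> = (\<integral>\<^sup>+w. (\<integral>\<^sup>+y. h y \<partial>K (X n w)) \<partial>P)"
    by (intro nn_integral_cong) auto
  also have "\<dots> = (\<integral>\<^sup>+x. (\<integral>\<^sup>+y. h y \<partial>K x) \<partial>L)" by (rule Suc.IH) measurable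
  also have "\<dots> = (\<integral>\<^sup>+x. h x \<partial>(L \<bind> K))"
    by (rule nn_integral_bind[where B=borel, symmetric]) simp_all
  finally show ?case by (simp add: bind_K)
qed

lemma distr_X: "distr P borel (X n) = L"
proof (rule measure_eqI)
  fix B assume "B \<in> sets (distr P borel (X n))"
  then have [measurable]: "B \<in> sets borel" by simp
  show "emeasure (distr P borel (X n)) B = emeasure L B"
    using nn_integral_X[of "indicator B" n] nn_integral_distr[of "X n" P borel "indicator B"] by simp
qed simp

lemma integrable_X: "integrable L f \<Longrightarrow> integrable P (\<lambda>w. f (X n w))" for f :: "'a \<Rightarrow> real"
  using integrable_distr[of "X n" P borel f] distr_X[of n] by simp

lemma integral_X: "integrable L f \<Longrightarrow> (\<integral>w. f (X n w) \<partial>P) = (\<integral>x. f x \<partial>L)" for f :: "'a \<Rightarrow> real"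
  using integral_distr[of "X n" P borel f] distr_X[of n] by (auto cong: measurable_cong_sets)

text \<open>A window of length \<open>k\<close> from time \<open>j\<close> ends at time
  \<open>j + (k - 1)\<close>. For \<open>k = 0\<close> the event is the whole space and belongs to
  every \<open>A n\<close>.\<close>

lemma rect_measurable:
  assumes "\<And>i. i < k \<Longrightarrow> B i \<in> sets borel"
  shows "{w \<in> space P. \<forall>i<k. X (j + i) w \<in> B i} \<in> sets (A (j + (k - 1)))"
proof -
  have "X (j + i) -` B i \<inter> space (A (j + (k - 1))) \<in> sets (A (j + (k - 1)))" if "i < k" for i
    using that by (intro measurable_sets[OF X_adapted] assms) auto
  then have "{w \<in> space P. X (j + i) w \<in> B i} \<in> sets (A (j + (k - 1)))" if "i < k" for i
    using that by (simp add: vimage_def Int_def conj_commute)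
  then have "{w \<in> space (A (j + (k - 1))). \<forall>i\<in>{..<k}. X (j + i) w \<in> B i} \<in> sets (A (j + (k - 1)))"
    by (intro sets.sets_Collect_finite_All) auto
  then show ?thesis by (simp only: space_A Ball_def lessThan_iff)
qed

text \<open>The free test function at the end of the window makes the induction work: the Markov
  property replaces \<open>h\<close> at the last time by its kernel integral one step earlier, and
  this together with the indicator of \<open>B k\<close> is the test function of the shorter
  window.\<close>

lemma rect_stationary:
  assumes "\<And>i. i < k \<Longrightarrow> B i \<in> sets borel" and [measurable]: "h \<in> borel_measurable borel"
  shows "(\<integral>\<^sup>+w. indicator {w \<in> space P. \<forall>i<k. X (j + i) w \<in> B i} w * h (X (j + k) w) \<partial>P)
    = (\<integral>\<^sup>+w. indicator {w \<in> space P. \<forall>i<k. X i w \<in> B i} w * h (X k w) \<partial>P)"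
  using assms
proof (induction k arbitrary: h)
  case 0
  have "(\<integral>\<^sup>+w. indicator {w \<in> space P. True} w * h (X j w) \<partial>P) = (\<integral>\<^sup>+x. h x \<partial>L)" for j
    unfolding nn_integral_X[OF 0(2), of j, symmetric] by (intro nn_integral_cong) auto
  then show ?case by simp
next
  case (Suc k)
  note [measurable] = Suc.prems(2)
  have [measurable]: "B k \<in> sets borel" using Suc.prems by simp
  have step: "(\<integral>\<^sup>+w. indicator {w \<in> space P. \<forall>i<Suc k. X (j + i) w \<in> B i} w * h (X (j + Suc k) w) \<partial>P)
      = (\<integral>\<^sup>+w. indicator {w \<in> space P. \<forall>i<k. X (j + i) w \<in> B i} w *
           (indicator (B k) (X (j + k) w) * (\<integral>\<^sup>+y. h y \<partial>K (X (j + k) w))) \<partial>P)" for j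
  proof -
    have S: "{w \<in> space P. \<forall>i<Suc k. X (j + i) w \<in> B i} \<in> sets (A (j + k))"
      using rect_measurable[of "Suc k" B j, OF Suc.prems(1)] by (simp only: diff_Suc_1)
    have "(\<integral>\<^sup>+w. indicator {w \<in> space P. \<forall>i<Suc k. X (j + i) w \<in> B i} w * h (X (Suc (j + k)) w) \<partial>P)
        = (\<integral>\<^sup>+w. indicator {w \<in> space P. \<forall>i<Suc k. X (j + i) w \<in> B i} w * (\<integral>\<^sup>+y. h y \<partial>K (X (j + k) w)) \<partial>P)"
      by (rule markov_nn_integral[OF S Suc.prems(2)])
    also have "\<dots> = (\<integral>\<^sup>+w. indicator {w \<in> space P. \<forall>i<k. X (j + i) w \<in> B i} w *
           (indicator (B k) (X (j + k) w) * (\<integral>\<^sup>+y. h y \<partial>K (X (j + k) w))) \<partial>P)"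
      by (intro nn_integral_cong) (auto simp: indicator_def less_Suc_eq)
    finally show ?thesis by (simp only: add_Suc_right)
  qed
  show ?case unfolding step[of j] step[of 0, unfolded add_0]
    by (rule Suc.IH) (use Suc.prems(1) in auto)
qed

lemma window_measurable: "(\<lambda>w. \<lambda>i\<in>{..<k}. X (j + i) w) \<in> P \<rightarrow>\<^sub>M PiM {..<k} (\<lambda>_. borel)"
  by (rule measurable_restrict) (rule X_measurable)

text \<open>Rectangles determine a finite measure on a finite product, and on them the claim is the
  previous stationarity with test function 1. Windows are all that is needed later, since maximal
  sums up to \<open>n\<close> read only \<open>n\<close> coordinates.\<close>

lemma window_distr:
  "distr P (PiM {..<k} (\<lambda>_. borel)) (\<lambda>w. \<lambda>i\<in>{..<k}. X (j + i) w)
    = distr P (PiM {..<k} (\<lambda>_. borel)) (\<lambda>w. \<lambda>i\<in>{..<k}. X i w)"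
  (is "?D j = ?D'")
proof (rule measure_eqI_PiM_finite)
  fix B :: "nat \<Rightarrow> 'a set" assume B: "\<And>i. i \<in> {..<k} \<Longrightarrow> B i \<in> sets borel"
  have *: "emeasure (distr P (PiM {..<k} (\<lambda>_. borel)) (\<lambda>w. \<lambda>i\<in>{..<k}. X (j + i) w)) (Pi\<^sub>E {..<k} B)
      = (\<integral>\<^sup>+w. indicator {w \<in> space P. \<forall>i<k. X (j + i) w \<in> B i} w * 1 \<partial>P)" for j
  proof -
    have R: "{w \<in> space P. \<forall>i<k. X (j + i) w \<in> B i} \<in> sets P"
    proof (rule sets_A_le, rule rect_measurable)
      show "B i \<in> sets borel" if "i < k" for i using B[of i] that by simp
    qed
    have eq: "(\<lambda>w. \<lambda>i\<in>{..<k}. X (j + i) w) -` (Pi\<^sub>E {..<k} B) \<inter> space P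
        = {w \<in> space P. \<forall>i<k. X (j + i) w \<in> B i}"
    proof (rule set_eqI)
      fix w
      show "w \<in> (\<lambda>w. \<lambda>i\<in>{..<k}. X (j + i) w) -` (Pi\<^sub>E {..<k} B) \<inter> space P
        \<longleftrightarrow> w \<in> {w \<in> space P. \<forall>i<k. X (j + i) w \<in> B i}"
        by (auto simp: PiE_iff)
    qed
    have "Pi\<^sub>E {..<k} B \<in> sets (PiM {..<k} (\<lambda>_. borel))"
      using B by (intro sets_PiM_I_finite) auto
    from emeasure_distr[OF window_measurable this, of j] show ?thesis
      by (simp only: eq nn_integral_indicator[OF R] mult_1_right)
  qed
  show "emeasure (?D j) (Pi\<^sub>E {..<k} B) = emeasure ?D' (Pi\<^sub>E {..<k} B)"
    unfolding *[of j] *[of 0, unfolded add_0] by (rule rect_stationary) (use B in auto)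
next
  show "range (\<lambda>_::nat. space (PiM {..<k} (\<lambda>_. borel :: 'a measure))) \<subseteq> prod_algebra {..<k} (\<lambda>_. borel)"
    by (auto simp: space_PiM intro!: prod_algebraI_finite)
  show "emeasure (?D j) (space (PiM {..<k} (\<lambda>_. borel :: 'a measure))) \<noteq> \<infinity>"
    unfolding emeasure_distr[OF window_measurable sets.top] P.emeasure_eq_measure infinity_ennreal_def by (rule ennreal_neq_top)
qed auto

lemma window_integral:
  fixes \<phi> :: "(nat \<Rightarrow> 'a) \<Rightarrow> real"
  assumes [measurable]: "\<phi> \<in> borel_measurable (PiM {..<k} (\<lambda>_. borel))"
  shows "(\<integral>w. \<phi> (\<lambda>i\<in>{..<k}. X (j + i) w) \<partial>P) = (\<integral>w. \<phi> (\<lambda>i\<in>{..<k}. X i w) \<partial>P)"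
proof -
  have "(\<integral>w. \<phi> (\<lambda>i\<in>{..<k}. X (j + i) w) \<partial>P)
      = (\<integral>x. \<phi> x \<partial>distr P (PiM {..<k} (\<lambda>_. borel)) (\<lambda>w. \<lambda>i\<in>{..<k}. X (j + i) w))" for j
    by (rule integral_distr[symmetric, OF window_measurable assms])
  from this[of j] this[of 0] show ?thesis unfolding window_distr[of k j] by (simp only: add_0)
qed

end

section \<open>The pointwise ergodic theorem\<close>

text \<open>The empty sum takes part, so the maximum is never negative, and a positive maximum is
  attained by a nonempty sum.\<close>

definition max_sum :: "nat \<Rightarrow> (nat \<Rightarrow> real) \<Rightarrow> real" where
  "max_sum n y = Max ((\<lambda>k. \<Sum>i<k. y i) ` {..n})"

lemma max_sum_ge: "k \<le> n \<Longrightarrow> (\<Sum>i<k. y i) \<le> max_sum n y"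
  by (auto simp: max_sum_def)

lemma max_sum_nonneg: "0 \<le> max_sum n y"
  using max_sum_ge[of 0 n y] by simp

lemma max_sum_attained: "\<exists>k\<le>n. max_sum n y = (\<Sum>i<k. y i)"
proof -
  have "max_sum n y \<in> (\<lambda>k. \<Sum>i<k. y i) ` {..n}"
    unfolding max_sum_def by (rule Max_in) auto
  then show ?thesis by auto
qed

lemma max_sum_le: "max_sum n y \<le> (\<Sum>i<n. \<bar>y i\<bar>)"
proof -
  obtain k where "k \<le> n" and eq: "max_sum n y = (\<Sum>i<k. y i)" using max_sum_attained by blast
  have "(\<Sum>i<k. y i) \<le> (\<Sum>i<k. \<bar>y i\<bar>)" by (rule sum_mono) simp
  also have "\<dots> \<le> (\<Sum>i<n. \<bar>y i\<bar>)" using \<open>k \<le> n\<close> by (intro sum_mono2) auto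
  finally show ?thesis by (simp add: eq)
qed

lemma max_sum_cong: "(\<And>i. i < n \<Longrightarrow> y i = z i) \<Longrightarrow> max_sum n y = max_sum n z"
  unfolding max_sum_def by (intro arg_cong[of _ _ Max] image_cong refl sum.cong) auto

text \<open>A positive maximum is attained at some \<open>Suc m\<close>; without its first term this
  sum is a partial sum of the shifted sequence.\<close>

lemma max_sum_shift:
  assumes "0 < max_sum n y" shows "max_sum n y \<le> y 0 + max_sum n (\<lambda>i. y (Suc i))"
proof -
  obtain k where k: "k \<le> n" and eq: "max_sum n y = (\<Sum>i<k. y i)" using max_sum_attained by blast
  with assms obtain m where m: "k = Suc m" by (cases k) auto
  show ?thesis unfolding eq m sum.lessThan_Suc_shift using k m by (intro add_left_mono max_sum_ge) simp
qed

lemma max_sum_mono: "m \<le> n \<Longrightarrow> max_sum m y \<le> max_sum n y"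
  unfolding max_sum_def by (intro Max_mono) auto

lemma max_sum_measurable [measurable]:
  assumes "\<And>i. i < n \<Longrightarrow> (\<lambda>x. y x i) \<in> borel_measurable M"
  shows "(\<lambda>x. max_sum n (y x)) \<in> borel_measurable M"
  unfolding max_sum_def by (intro borel_measurable_Max borel_measurable_sum assms) auto

context stationary_chain
begin

text \<open>Garsia's argument:
  a positive maximal sum exceeds the one of the shifted chain by at most \<open>f (X 0 w)\<close>.\<close>

lemma maximal_ergodic:
  assumes f: "integrable L f"
  shows "0 \<le> (\<integral>w. indicator {w \<in> space P. 0 < max_sum n (\<lambda>i. f (X i w))} w * f (X 0 w) \<partial>P)"
proof -
  have [measurable]: "f \<in> borel_measurable borel" using f by (simp cong: measurable_cong_sets)
  have fX [simp]: "integrable P (\<lambda>w. f (X i w))" for i by (rule integrable_X[OF f])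
  let ?M = "\<lambda>j w. max_sum n (\<lambda>i. f (X (j + i) w))"
  have int [simp]: "integrable P (?M j)" for j
  proof (rule Bochner_Integration.integrable_bound)
    show "integrable P (\<lambda>w. \<Sum>i<n. \<bar>f (X (j + i) w)\<bar>)" by (intro Bochner_Integration.integrable_sum) simp
    show "AE w in P. norm (?M j w) \<le> norm (\<Sum>i<n. \<bar>f (X (j + i) w)\<bar>)"
    proof (rule AE_I2)
      fix w show "norm (?M j w) \<le> norm (\<Sum>i<n. \<bar>f (X (j + i) w)\<bar>)"
        using max_sum_nonneg[of n "\<lambda>i. f (X (j + i) w)"] max_sum_le[of n "\<lambda>i. f (X (j + i) w)"] by simp
    qed
  qed measurable
  have win: "(\<integral>w. ?M j w \<partial>P) = (\<integral>w. max_sum n (\<lambda>i. f ((\<lambda>i\<in>{..<n}. X (j + i) w) i)) \<partial>P)" for j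
    by (intro Bochner_Integration.integral_cong refl max_sum_cong) simp
  have m: "(\<lambda>x. max_sum n (\<lambda>i. f (x i))) \<in> borel_measurable (PiM {..<n} (\<lambda>_. borel))"
    by measurable
  \<comment> \<open>Stationarity enters here: the expectations of the original and the shifted
    maximal sum cancel, and only the term with \<open>f (X 0 w)\<close> remains.\<close>
  have eq: "(\<integral>w. ?M 1 w \<partial>P) = (\<integral>w. ?M 0 w \<partial>P)"
    using window_integral[OF m, of 1] unfolding win by simp
  let ?E = "{w \<in> space P. 0 < max_sum n (\<lambda>i. f (X i w))}"
  have E [measurable]: "?E \<in> sets P" by measurable
  have intE [simp]: "integrable P (\<lambda>w. indicator ?E w * f (X 0 w))"
    using integrable_mult_indicator[OF E fX[of 0]] by simp
  have "(\<integral>w. ?M 0 w \<partial>P) \<le> (\<integral>w. indicator ?E w * f (X 0 w) + ?M 1 w \<partial>P)"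
  proof (rule integral_mono)
    fix w assume w: "w \<in> space P"
    \<comment> \<open>Off the event the left side is 0 and \<open>?M 1 w\<close> is
      nonnegative.\<close>
    show "?M 0 w \<le> indicator ?E w * f (X 0 w) + ?M 1 w"
      using max_sum_shift[of n "\<lambda>i. f (X i w)"] max_sum_nonneg[of n "\<lambda>i. f (X (Suc i) w)"] w
      by (cases "0 < max_sum n (\<lambda>i. f (X i w))") auto
  qed (simp_all only: int intE Bochner_Integration.integrable_add)
  also have "\<dots> = (\<integral>w. indicator ?E w * f (X 0 w) \<partial>P) + (\<integral>w. ?M 1 w \<partial>P)"
    by (rule Bochner_Integration.integral_add) (simp_all only: int intE)
  finally show ?thesis using eq by simp
qed

text \<open>The preceding estimate for \<open>f - e\<close> bounds \<open>e\<close> times the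
  probability of \<open>?E n\<close> by the integral of \<open>f\<close> over it, hence by the full
  integral as \<open>f\<close> is nonnegative. The events increase with \<open>n\<close>, so the
  bound passes to their union.\<close>

lemma maximal_inequality:
  assumes f: "integrable L f" and nonneg: "\<And>x. 0 \<le> f x" and e: "0 < e"
  shows "measure P {w \<in> space P. \<exists>n. e * real n < (\<Sum>i<n. f (X i w))} \<le> (\<integral>x. f x \<partial>L) / e"
proof -
  have [measurable]: "f \<in> borel_measurable borel" using f by (simp cong: measurable_cong_sets)
  let ?E = "\<lambda>n. {w \<in> space P. 0 < max_sum n (\<lambda>i. f (X i w) - e)}"
  have Em [measurable]: "?E n \<in> sets P" for n by measurable
  have le: "measure P (?E n) \<le> (\<integral>x. f x \<partial>L) / e" for n
  proof -
    have i1: "integrable P (\<lambda>w. indicator (?E n) w * f (X 0 w))"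
      using integrable_mult_indicator[OF Em integrable_X[OF f, of 0]] by simp
    have i2: "integrable P (\<lambda>w. indicator (?E n) w * e)"
      by (intro integrable_mult_left) (simp add: P.emeasure_eq_measure less_top[symmetric])
    have "0 \<le> (\<integral>w. indicator (?E n) w * (f (X 0 w) - e) \<partial>P)"
      by (rule maximal_ergodic) (use f in simp)
    also have "\<dots> = (\<integral>w. indicator (?E n) w * f (X 0 w) \<partial>P) - measure P (?E n) * e"
      using Bochner_Integration.integral_diff[OF i1 i2] by (simp add: right_diff_distrib)
    also have "(\<integral>w. indicator (?E n) w * f (X 0 w) \<partial>P) \<le> (\<integral>w. f (X 0 w) \<partial>P)"
      by (intro integral_mono i1 integrable_X[OF f]) (auto simp: indicator_def nonneg)
    finally show ?thesis using e by (simp add: integral_X[OF f] field_simps)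
  qed
  have "incseq ?E" by (auto simp: incseq_def intro: less_le_trans[OF _ max_sum_mono])
  then have "(\<lambda>n. measure P (?E n)) \<longlonglongrightarrow> measure P (\<Union>n. ?E n)"
    by (intro P.finite_Lim_measure_incseq) auto
  then have "measure P (\<Union>n. ?E n) \<le> (\<integral>x. f x \<partial>L) / e"
    by (rule LIMSEQ_le_const2) (use le in auto)
  moreover have "measure P {w \<in> space P. \<exists>n. e * real n < (\<Sum>i<n. f (X i w))} \<le> measure P (\<Union>n. ?E n)"
  proof (rule P.finite_measure_mono)
    show "{w \<in> space P. \<exists>n. e * real n < (\<Sum>i<n. f (X i w))} \<subseteq> (\<Union>n. ?E n)"
    proof safe
      fix w n assume w: "w \<in> space P" and "e * real n < (\<Sum>i<n. f (X i w))"
      then have "0 < (\<Sum>i<n. f (X i w) - e)" by (simp add: sum_subtractf mult.commute)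
      also have "\<dots> \<le> max_sum n (\<lambda>i. f (X i w) - e)" by (rule max_sum_ge) simp
      finally show "w \<in> (\<Union>n. ?E n)" using w by auto
    qed
  qed auto
  ultimately show ?thesis by linarith
qed

text \<open>
  The sum of \<open>h - kop h\<close> along the chain is a martingale up to bounded boundary terms. Its second
  moment grows linearly, so it is \<open>o(n)\<close> along the squares, and bounded increments fill the gaps.
\<close>

definition mart :: "('a \<Rightarrow> real) \<Rightarrow> nat \<Rightarrow> 'w \<Rightarrow> real" where
  "mart h n w = (\<Sum>i<n. h (X (Suc i) w) - kop h (X i w))"

lemma mart_incr_bound:
  assumes "h \<in> bdd_meas B" shows "\<bar>h (X (Suc i) w) - kop h (X i w)\<bar> \<le> 2 * B"
  using bdd_measD(2)[OF assms, of "X (Suc i) w"] bdd_measD(2)[OF kop_bdd_meas[OF assms], of "X i w"]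
  by linarith

lemma mart_bound:
  assumes "h \<in> bdd_meas B" "m \<le> n" shows "\<bar>mart h n w - mart h m w\<bar> \<le> 2 * B * (real n - real m)"
proof -
  have "mart h n w - mart h m w = (\<Sum>i\<in>{m..<n}. h (X (Suc i) w) - kop h (X i w))"
    unfolding mart_def using sum_diff_nat_ivl[of 0 m n "\<lambda>i. h (X (Suc i) w) - kop h (X i w)"] \<open>m \<le> n\<close>
    by (simp add: lessThan_atLeast0)
  also have "\<bar>\<dots>\<bar> \<le> (\<Sum>i\<in>{m..<n}. \<bar>h (X (Suc i) w) - kop h (X i w)\<bar>)" by (rule sum_abs)
  also have "\<dots> \<le> (\<Sum>i\<in>{m..<n}. 2 * B)" by (intro sum_mono mart_incr_bound assms)
  also have "\<dots> = 2 * B * (real n - real m)" using \<open>m \<le> n\<close> by (simp add: of_nat_diff)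
  finally show ?thesis .
qed

lemma mart_adapted:
  assumes "h \<in> bdd_meas B" shows "mart h n \<in> borel_measurable (A n)"
  unfolding mart_def
  by (intro borel_measurable_sum borel_measurable_diff
      measurable_compose[OF X_adapted bdd_measD(1)[OF assms]]
      measurable_compose[OF X_adapted bdd_measD(1)[OF kop_bdd_meas[OF assms]]]) auto

text \<open>Each increment is orthogonal to the past: \<open>mart h n\<close> is measurable for
  \<open>A n\<close>, and the conditional expectation of \<open>h (X (Suc n) w)\<close> is
  \<open>kop h (X n w)\<close>. Hence every step adds at most the squared bound
  \<open>(2 * B)\<^sup>2\<close>.\<close>

lemma mart_second_moment:
  assumes h: "h \<in> bdd_meas B"
  shows "integrable P (\<lambda>w. (mart h n w)\<^sup>2)" "(\<integral>w. (mart h n w)\<^sup>2 \<partial>P) \<le> 4 * B\<^sup>2 * real n"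
proof -
  have [measurable]: "h \<in> borel_measurable borel" "kop h \<in> borel_measurable borel"
    using bdd_measD(1)[OF h] bdd_measD(1)[OF kop_bdd_meas[OF h]] .
  have B: "0 \<le> B" using bdd_measD(2)[OF h, of undefined] by linarith
  have mm [measurable]: "mart h n \<in> borel_measurable P" for n
    by (rule adapted_measurable[OF mart_adapted[OF h]])
  have mb: "\<bar>mart h n w\<bar> \<le> 2 * B * real n" for n w
    using mart_bound[OF h, of 0 n w] by (simp add: mart_def)
  have int [simp]: "integrable P (\<lambda>w. mart h n w * Z w)"
    if [measurable]: "Z \<in> borel_measurable P" and Z: "\<And>w. \<bar>Z w\<bar> \<le> C" for n Z C
    by (rule P.integrable_const_bound[where B="2 * B * real n * C"])
       (use mb[of n] Z B in \<open>auto simp: abs_mult intro!: mult_mono\<close>)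
  have sq: "integrable P (\<lambda>w. (mart h n w)\<^sup>2)" for n
    unfolding power2_eq_square by (rule int[OF mm mb])
  show "integrable P (\<lambda>w. (mart h n w)\<^sup>2)" by (rule sq)
  show "(\<integral>w. (mart h n w)\<^sup>2 \<partial>P) \<le> 4 * B\<^sup>2 * real n"
  proof (induction n)
    case (Suc n)
    interpret sigma_finite_subalgebra P "A n" by (rule sigma_finite_A)
    let ?d = "\<lambda>w. h (X (Suc n) w) - kop h (X n w)"
    have ih: "integrable P (\<lambda>w. mart h n w * h (X (Suc n) w))"
      by (rule int[OF _ bdd_measD(2)[OF h]]) measurable
    have ik: "integrable P (\<lambda>w. mart h n w * kop h (X n w))"
      by (rule int[OF _ bdd_measD(2)[OF kop_bdd_meas[OF h]]]) measurable
    have "(\<integral>w. mart h n w * h (X (Suc n) w) \<partial>P)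
        = (\<integral>w. mart h n w * real_cond_exp P (A n) (\<lambda>w. h (X (Suc n) w)) w \<partial>P)"
      by (rule real_cond_exp_intg(2)[symmetric, OF ih mart_adapted[OF h]]) measurable
    also have "\<dots> = (\<integral>w. mart h n w * kop h (X n w) \<partial>P)"
      using markov_cond_exp[OF h, of n] by (intro integral_cong_AE) (auto elim: eventually_mono)
    finally have orth: "(\<integral>w. mart h n w * ?d w \<partial>P) = 0"
      using ih ik by (simp add: right_diff_distrib)
    have id: "integrable P (\<lambda>w. mart h n w * ?d w)"
      using ih ik by (simp add: right_diff_distrib)
    have d2: "(?d w)\<^sup>2 \<le> 4 * B\<^sup>2" for w
      using power_mono[OF mart_incr_bound[OF h, of n w], of 2] by (simp add: power_mult_distrib)
    have id2: "integrable P (\<lambda>w. (?d w)\<^sup>2)"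
      by (rule P.integrable_const_bound[where B="4 * B\<^sup>2"]) (use d2 in auto)
    have "(\<integral>w. (mart h (Suc n) w)\<^sup>2 \<partial>P) = (\<integral>w. (mart h n w)\<^sup>2 + 2 * (mart h n w * ?d w) + (?d w)\<^sup>2 \<partial>P)"
      by (intro Bochner_Integration.integral_cong) (simp_all add: mart_def power2_sum)
    also have "\<dots> = (\<integral>w. (mart h n w)\<^sup>2 \<partial>P) + 2 * (\<integral>w. mart h n w * ?d w \<partial>P) + (\<integral>w. (?d w)\<^sup>2 \<partial>P)"
      using sq[of n] id id2 by (subst Bochner_Integration.integral_add) auto
    also have "\<dots> \<le> 4 * B\<^sup>2 * real n + 0 + (\<integral>w. 4 * B\<^sup>2 \<partial>P)"
      using Suc.IH orth id2 d2 by (intro add_mono integral_mono) auto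
    also have "\<dots> = 4 * B\<^sup>2 * real (Suc n)" using P.prob_space by (simp add: algebra_simps)
    finally show ?case .
  qed (simp add: mart_def)
qed

text \<open>At time \<open>k\<^sup>2\<close> the normalised second moment is at most
  \<open>4 * B\<^sup>2 / k\<^sup>2\<close>, which is summable. Between consecutive squares lie at
  most \<open>2 * k\<close> further steps, which change the sum by at most \<open>4 * B * k\<close>,
  negligible against \<open>k\<^sup>2\<close>.\<close>

lemma mart_over_n:
  assumes h: "h \<in> bdd_meas B"
  shows "AE w in P. (\<lambda>n. mart h n w / real n) \<longlonglongrightarrow> 0"
proof -
  have B: "0 \<le> B" using bdd_measD(2)[OF h, of undefined] by linarith
  have "AE w in P. summable (\<lambda>k. (mart h (k\<^sup>2) w / real (k\<^sup>2))\<^sup>2)"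
  proof (rule AE_summable_if_summable_integral)
    show "integrable P (\<lambda>w. (mart h (k\<^sup>2) w / real (k\<^sup>2))\<^sup>2)" for k
      unfolding power_divide using mart_second_moment(1)[OF h, of "k\<^sup>2"] by (rule integrable_divide_zero)
    show "summable (\<lambda>k. \<integral>w. (mart h (k\<^sup>2) w / real (k\<^sup>2))\<^sup>2 \<partial>P)"
    proof (rule summable_comparison_test')
      show "summable (\<lambda>k. 4 * B\<^sup>2 * inverse (real k ^ 2))"
        by (intro summable_mult inverse_power_summable) simp
      fix k :: nat
      have "(\<integral>w. (mart h (k\<^sup>2) w / real (k\<^sup>2))\<^sup>2 \<partial>P) = (\<integral>w. (mart h (k\<^sup>2) w)\<^sup>2 \<partial>P) / (real (k\<^sup>2))\<^sup>2"
        by (simp add: power_divide)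
      also have "\<dots> \<le> 4 * B\<^sup>2 * real (k\<^sup>2) / (real (k\<^sup>2))\<^sup>2"
        by (intro divide_right_mono mart_second_moment(2)[OF h]) simp
      also have "\<dots> = 4 * B\<^sup>2 * inverse (real k ^ 2)"
        by (simp add: power2_eq_square divide_simps)
      finally show "norm (\<integral>w. (mart h (k\<^sup>2) w / real (k\<^sup>2))\<^sup>2 \<partial>P) \<le> 4 * B\<^sup>2 * inverse (real k ^ 2)"
        by simp
    qed
  qed simp
  then show ?thesis
  proof eventually_elim
    fix w assume "summable (\<lambda>k. (mart h (k\<^sup>2) w / real (k\<^sup>2))\<^sup>2)"
    then have "(\<lambda>k. (mart h (k\<^sup>2) w / real (k\<^sup>2))\<^sup>2) \<longlonglongrightarrow> 0" by (rule summable_LIMSEQ_zero)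
    then have 1: "(\<lambda>k. mart h (k\<^sup>2) w / real (k\<^sup>2)) \<longlonglongrightarrow> 0"
      by (simp only: power_tendsto_0_iff zero_less_numeral)
    have 2: "(\<lambda>k. \<bar>mart h (k\<^sup>2) w / real (k\<^sup>2)\<bar> + 4 * B * inverse (real k)) \<longlonglongrightarrow> 0"
      using tendsto_add[OF tendsto_rabs[OF 1] tendsto_mult[OF tendsto_const[of "4*B"] lim_inverse_n]]
      by simp
    have fs: "filterlim floor_sqrt sequentially sequentially"
      unfolding filterlim_at_top
    proof
      fix Z show "\<forall>\<^sub>F n in sequentially. Z \<le> floor_sqrt n"
        using eventually_ge_at_top[of "Z\<^sup>2"] by eventually_elim (rule le_floor_sqrtI)
    qed
    have 3: "(\<lambda>n. \<bar>mart h ((floor_sqrt n)\<^sup>2) w / real ((floor_sqrt n)\<^sup>2)\<bar> + 4 * B * inverse (real (floor_sqrt n))) \<longlonglongrightarrow> 0"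
      by (rule filterlim_compose[OF 2 fs])
    show "(\<lambda>n. mart h n w / real n) \<longlonglongrightarrow> 0"
    proof (rule tendsto_0_le[OF 3, of _ 1])
      show "\<forall>\<^sub>F n in sequentially. norm (mart h n w / real n) \<le>
        norm (\<bar>mart h ((floor_sqrt n)\<^sup>2) w / real ((floor_sqrt n)\<^sup>2)\<bar> + 4 * B * inverse (real (floor_sqrt n))) * 1"
        using eventually_gt_at_top[of 0]
      proof eventually_elim
        fix n :: nat assume n: "0 < n"
        define k where "k = floor_sqrt n"
        have k0: "0 < k" using n by (simp add: k_def)
        have k1: "k\<^sup>2 \<le> n" by (simp add: k_def)
        \<comment> \<open>Strictness matters: it sharpens the gap from \<open>2 * k + 1\<close> to
          \<open>2 * k\<close>.\<close>
        have "n < (Suc k)\<^sup>2" unfolding k_def by (rule Suc_floor_sqrt_power2_gt)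
        then have "n \<le> k\<^sup>2 + 2 * k" by (simp add: power2_eq_square)
        then have "real n \<le> real (k\<^sup>2 + 2 * k)" by (simp only: of_nat_le_iff)
        then have k2: "real n - real (k\<^sup>2) \<le> 2 * real k" by simp
        have "\<bar>mart h n w\<bar> \<le> \<bar>mart h (k\<^sup>2) w\<bar> + 2 * B * (real n - real (k\<^sup>2))"
          using mart_bound[OF h k1, of w] by linarith
        also have "\<dots> \<le> \<bar>mart h (k\<^sup>2) w\<bar> + 2 * B * (2 * real k)"
          using k2 B by (intro add_left_mono mult_left_mono) auto
        finally have m: "\<bar>mart h n w\<bar> \<le> \<bar>mart h (k\<^sup>2) w\<bar> + 4 * B * real k" by simp
        have "\<bar>mart h n w / real n\<bar> \<le> (\<bar>mart h (k\<^sup>2) w\<bar> + 4 * B * real k) / real n"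
          using m n by (simp add: abs_divide divide_right_mono)
        also have "\<dots> \<le> (\<bar>mart h (k\<^sup>2) w\<bar> + 4 * B * real k) / real (k\<^sup>2)"
          using k1 k0 B n by (intro divide_left_mono) (auto intro!: add_nonneg_nonneg mult_pos_pos simp flip: of_nat_power)
        also have "\<dots> = \<bar>mart h (k\<^sup>2) w / real (k\<^sup>2)\<bar> + 4 * B * inverse (real k)"
        proof -
          have "real k / real (k\<^sup>2) = inverse (real k)" using k0 by (simp add: power2_eq_square divide_simps)
          then have "4 * B * real k / real (k\<^sup>2) = 4 * B * inverse (real k)"
            by (simp only: times_divide_eq_right[symmetric])
          then show ?thesis by (simp only: add_divide_distrib abs_divide abs_of_nat)
        qed
        finally show "norm (mart h n w / real n) \<le>
          norm (\<bar>mart h ((floor_sqrt n)\<^sup>2) w / real ((floor_sqrt n)\<^sup>2)\<bar> + 4 * B * inverse (real (floor_sqrt n))) * 1"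
          unfolding k_def[symmetric] by simp
      qed
    qed
  qed
qed

section \<open>Averages along the chain\<close>

lemma coboundary_average:
  assumes h: "h \<in> bdd_meas B"
  shows "AE w in P. (\<lambda>n. (\<Sum>i<n. h (X i w) - kop h (X i w)) / real n) \<longlonglongrightarrow> 0"
  using mart_over_n[OF h]
proof eventually_elim
  fix w assume 1: "(\<lambda>n. mart h n w / real n) \<longlonglongrightarrow> 0"
  have tel: "(\<Sum>i<n. h (X i w) - kop h (X i w)) = mart h n w + (h (X 0 w) - h (X n w))" for n
    by (induction n) (simp_all add: mart_def)
  have lim: "(\<lambda>n. (2 * B) * inverse (real n)) \<longlonglongrightarrow> 0"
    using tendsto_mult[OF tendsto_const lim_inverse_n, of "2 * B"] by simp
  have "(\<lambda>n. (h (X 0 w) - h (X n w)) / real n) \<longlonglongrightarrow> 0"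
  proof (rule tendsto_0_le[OF lim always_eventually], rule allI)
    fix n
    have "\<bar>h (X 0 w) - h (X n w)\<bar> \<le> 2 * B"
      using bdd_measD(2)[OF h, of "X 0 w"] bdd_measD(2)[OF h, of "X n w"] by linarith
    then show "norm ((h (X 0 w) - h (X n w)) / real n) \<le> norm ((2 * B) * inverse (real n)) * 1"
      by (auto simp: abs_divide abs_mult divide_inverse intro!: mult_right_mono)
  qed
  from tendsto_add[OF 1 this] show "(\<lambda>n. (\<Sum>i<n. h (X i w) - kop h (X i w)) / real n) \<longlonglongrightarrow> 0"
    by (simp add: tel add_divide_distrib)
qed

text \<open>With \<open>L\<^sup>1\<close> error \<open>(1/4) ^ j\<close> and threshold
  \<open>(1/2) ^ j\<close>, the maximal inequality gives exceptional events of probability at most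
  \<open>(1/2) ^ j\<close>. By Borel-Cantelli almost every path avoids them for all large
  \<open>j\<close>; there the averages of \<open>r j\<close> are at most \<open>(1/2) ^ j\<close> at
  every time, while the coboundary part vanishes in the limit.\<close>

lemma birkhoff:
  assumes f: "integrable L f"
  shows "AE w in P. (\<lambda>n. (\<Sum>i<n. f (X i w)) / real n) \<longlonglongrightarrow> (\<integral>x. f x \<partial>L)"
proof -
  have [measurable]: "f \<in> borel_measurable borel" using f by (simp cong: measurable_cong_sets)
  define c where "c = (\<integral>x. f x \<partial>L)"
  have "\<exists>h. (\<exists>B. h \<in> bdd_meas B) \<and> (\<integral>x. \<bar>f x - c - (h x - kop h x)\<bar> \<partial>L) < (1/4) ^ j" for j :: nat
    using coboundary_approx[OF f, of "(1/4) ^ j"] by (auto simp: c_def)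
  then obtain h where hb: "\<And>j. \<exists>B. h j \<in> bdd_meas B"
    and hl: "\<And>j. (\<integral>x. \<bar>f x - c - (h j x - kop (h j) x)\<bar> \<partial>L) < (1/4) ^ j" by metis
  define r where "r j x = f x - c - (h j x - kop (h j) x)" for j x
  have ri: "integrable L (r j)" for j
  proof -
    obtain B where "h j \<in> bdd_meas B" using hb by blast
    then show ?thesis using f integrable_bdd_L kop_bdd_meas unfolding r_def by (auto intro!: Bochner_Integration.integrable_diff)
  qed
  have [measurable]: "r j \<in> borel_measurable borel" for j using ri[of j] by (simp cong: measurable_cong_sets)
  define E where "E j = {w \<in> space P. \<exists>n. (1/2) ^ j * real n < (\<Sum>i<n. \<bar>r j (X i w)\<bar>)}" for j
  have Em [measurable]: "E j \<in> sets P" for j unfolding E_def by measurable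
  have "measure P (E j) \<le> (1/2) ^ j" for j
  proof -
    have "measure P (E j) \<le> (\<integral>x. \<bar>r j x\<bar> \<partial>L) / (1/2) ^ j"
      unfolding E_def by (rule maximal_inequality) (use ri in auto)
    also have "\<dots> \<le> (1/4) ^ j / (1/2) ^ j"
      using hl[of j] by (intro divide_right_mono) (auto simp: r_def)
    also have "\<dots> = (1/2) ^ j" by (simp flip: power_divide)
    finally show ?thesis .
  qed
  then have "summable (\<lambda>j. measure P (E j))"
    by (intro summable_comparison_test'[OF summable_geometric[of "1/2::real"]]) auto
  then have bc: "AE w in P. eventually (\<lambda>j. w \<in> space P - E j) sequentially"
    by (intro borel_cantelli_AE1) (auto simp: P.emeasure_eq_measure)
  have "AE w in P. (\<lambda>n. (\<Sum>i<n. h j (X i w) - kop (h j) (X i w)) / real n) \<longlonglongrightarrow> 0" for j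
    using coboundary_average hb by blast
  then have "AE w in P. \<forall>j. (\<lambda>n. (\<Sum>i<n. h j (X i w) - kop (h j) (X i w)) / real n) \<longlonglongrightarrow> 0"
    by (simp add: AE_all_countable)
  with bc show ?thesis
  proof eventually_elim
    fix w assume ev: "eventually (\<lambda>j. w \<in> space P - E j) sequentially"
      and cob: "\<forall>j. (\<lambda>n. (\<Sum>i<n. h j (X i w) - kop (h j) (X i w)) / real n) \<longlonglongrightarrow> 0"
    show "(\<lambda>n. (\<Sum>i<n. f (X i w)) / real n) \<longlonglongrightarrow> (\<integral>x. f x \<partial>L)"
      unfolding c_def[symmetric]
    proof (rule tendstoI)
      fix e :: real assume e: "0 < e"
      have "(\<lambda>j. (1/2::real) ^ j) \<longlonglongrightarrow> 0" by (rule LIMSEQ_power_zero) simp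
      then have "eventually (\<lambda>j. (1/2::real) ^ j < e/2) sequentially"
        using e by (intro order_tendstoD(2)) auto
      with ev have "eventually (\<lambda>j. w \<in> space P - E j \<and> (1/2::real) ^ j < e/2) sequentially"
        by eventually_elim simp
      then obtain j where jE: "w \<in> space P" "w \<notin> E j" and je: "(1/2::real) ^ j < e/2"
        using eventually_happens by fastforce
      have rb: "(\<Sum>i<n. \<bar>r j (X i w)\<bar>) \<le> (1/2) ^ j * real n" for n
        using jE by (auto simp: E_def not_less)
      have "eventually (\<lambda>n. dist ((\<Sum>i<n. h j (X i w) - kop (h j) (X i w)) / real n) 0 < e/2) sequentially"
        using cob e by (intro tendstoD) auto
      then show "\<forall>\<^sub>F n in sequentially. dist ((\<Sum>i<n. f (X i w)) / real n) c < e"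
        using eventually_gt_at_top[of 0]
      proof eventually_elim
        fix n :: nat assume d: "dist ((\<Sum>i<n. h j (X i w) - kop (h j) (X i w)) / real n) 0 < e/2" and n: "0 < n"
        have "(\<Sum>i<n. f (X i w)) = (\<Sum>i<n. r j (X i w) + c + (h j (X i w) - kop (h j) (X i w)))"
          by (intro sum.cong) (auto simp: r_def)
        also have "\<dots> = (\<Sum>i<n. r j (X i w)) + real n * c + (\<Sum>i<n. h j (X i w) - kop (h j) (X i w))"
          by (simp add: sum.distrib)
        finally have "(\<Sum>i<n. f (X i w)) / real n - c
            = (\<Sum>i<n. r j (X i w)) / real n + (\<Sum>i<n. h j (X i w) - kop (h j) (X i w)) / real n"
          using n by (simp add: field_simps)
        moreover have "\<bar>(\<Sum>i<n. r j (X i w)) / real n\<bar> < e/2"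
        proof -
          have "\<bar>(\<Sum>i<n. r j (X i w))\<bar> \<le> (1/2) ^ j * real n" using sum_abs rb by (rule order_trans)
          then have "\<bar>(\<Sum>i<n. r j (X i w)) / real n\<bar> \<le> (1/2) ^ j"
            using n by (simp add: abs_divide divide_le_eq)
          with je show ?thesis by linarith
        qed
        ultimately show "dist ((\<Sum>i<n. f (X i w)) / real n) c < e"
          using d by (simp only: dist_real_def)
      qed
    qed
  qed
qed

end

section \<open>Minimisers of functions of quadratic growth\<close>

lemma dist_sq_le: "(dist p q)\<^sup>2 \<le> 2 * (dist x p)\<^sup>2 + 2 * (dist x q)\<^sup>2"
  for p q x :: "'a::metric_space"
proof -
  have "(dist p q)\<^sup>2 \<le> (dist x p + dist x q)\<^sup>2"
    by (intro power_mono dist_triangle3) simp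
  also have "\<dots> \<le> 2 * (dist x p)\<^sup>2 + 2 * (dist x q)\<^sup>2"
    using zero_le_power2[of "dist x p - dist x q"] by (simp add: power2_sum power2_diff)
  finally show ?thesis .
qed

text \<open>After factoring the difference of squares, the linear term \<open>2 * dist x y\<close>
  is traded for a multiple of \<open>(dist x y)\<^sup>2\<close> plus a constant. The bound is then
  affine in the squared distance to \<open>y\<close>, and averaging over \<open>x\<close> turns it
  into the value at \<open>y\<close> of the averaged function.\<close>

lemma dist_sq_diff_le:
  fixes p q x y :: "'a::metric_space"
  assumes "dist y p \<le> R" "dist y q \<le> R"
  shows "\<bar>(dist x p)\<^sup>2 - (dist x q)\<^sup>2\<bar> \<le> dist p q * (2 + 2 * (dist x y)\<^sup>2 + 2 * R)"
proof -
  have "\<bar>(dist x p)\<^sup>2 - (dist x q)\<^sup>2\<bar> = \<bar>dist x p - dist x q\<bar> * (dist x p + dist x q)"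
    by (simp add: power2_eq_square square_diff_square_factored abs_mult)
  also have "\<dots> \<le> dist p q * (2 * dist x y + 2 * R)"
    using assms dist_triangle[of x p y] dist_triangle[of x q y] abs_dist_diff_le[of p x q]
    by (intro mult_mono) (auto simp: dist_commute)
  also have "\<dots> \<le> dist p q * (2 + 2 * (dist x y)\<^sup>2 + 2 * R)"
  proof (rule mult_left_mono)
    have "2 * dist x y \<le> 1 + (dist x y)\<^sup>2"
      using zero_le_power2[of "dist x y - 1"] by (simp add: power2_diff)
    with zero_le_power2[of "dist x y"] show "2 * dist x y + 2 * R \<le> 2 + 2 * (dist x y)\<^sup>2 + 2 * R"
      by linarith
  qed simp
  finally show ?thesis .
qed

text \<open>Exactly what averaging over a probability measure preserves. The Frechet function and
  the sample functions share it with the same constants, the only dependence on \<open>F\<close>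
  being through \<open>F y\<close> and the two values in \<open>growth\<close>.\<close>

locale quadratic_growth =
  fixes F :: "'a::metric_space \<Rightarrow> real" and y :: 'a
  assumes growth: "(dist p q)\<^sup>2 \<le> 2 * F p + 2 * F q"
    and lipschitz: "dist y p \<le> R \<Longrightarrow> dist y q \<le> R \<Longrightarrow> \<bar>F p - F q\<bar> \<le> dist p q * (2 + 2 * F y + 2 * R)"
begin

lemma nonneg: "0 \<le> F p"
  using growth[of p p] by simp

lemma minimiser_bound:
  assumes "\<And>p. F u \<le> F p" shows "(dist y u)\<^sup>2 \<le> 4 * F y"
  using growth[of y u] assms[of y] by linarith

lemma continuous_on_cball: "continuous_on (cball y R) F"
proof (cases "0 \<le> R")
  case True
  have "(2 + 2 * F y + 2 * R)-lipschitz_on (cball y R) F"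
    using lipschitz[of _ R] nonneg[of y] True
    by (intro lipschitz_onI) (auto simp: dist_real_def mult.commute)
  then show ?thesis by (rule lipschitz_on_continuous_on)
qed (simp add: cball_empty)

text \<open>Outside the ball of radius \<open>sqrt (4 * F y)\<close> growth forces values above
  \<open>F y\<close>, so the minimum over this compact ball is global. Existence is essential: the
  excess of a nonempty set over an empty one is infinite.\<close>

lemma minimiser_exists:
  assumes proper: "\<And>(x::'a) r. compact (cball x r)"
  shows "\<exists>u. \<forall>p. F u \<le> F p"
proof -
  define R where "R = sqrt (4 * F y)"
  have "y \<in> cball y R" using nonneg[of y] by (simp add: R_def)
  then obtain u where u: "u \<in> cball y R" "\<And>p. p \<in> cball y R \<Longrightarrow> F u \<le> F p"
    using continuous_attains_inf[OF proper[of y R] _ continuous_on_cball] by blast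
  have "F u \<le> F p" for p
  proof (cases "p \<in> cball y R")
    case False
    then have "\<not> (dist y p)\<^sup>2 \<le> 4 * F y" using real_le_rsqrt[of "dist y p" "4 * F y"] by (auto simp: R_def)
    then have "F y \<le> F p" using growth[of y p] by linarith
    with u(2)[OF \<open>y \<in> cball y R\<close>] show ?thesis by simp
  qed (use u in auto)
  then show ?thesis by blast
qed

end

lemma proper_separable:
  fixes y :: "'a::metric_space"
  assumes proper: "\<And>(x::'a) r. compact (cball x r)"
  obtains D :: "'a set" where "countable D" "y \<in> D" "\<And>x e. 0 < e \<Longrightarrow> \<exists>z\<in>D. dist z x < e"
proof -
  have "\<exists>N. finite N \<and> cball y (real m) \<subseteq> (\<Union>z\<in>N. ball z (inverse (real (Suc m))))" for m
  proof (rule compactE_image[OF proper[of y "real m"], of "cball y (real m)" "\<lambda>z. ball z (inverse (real (Suc m)))"])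
    show "cball y (real m) \<subseteq> (\<Union>z\<in>cball y (real m). ball z (inverse (real (Suc m))))"
      by (force simp: UN_iff)
  qed auto
  then obtain N where fin: "\<And>m. finite (N m)"
    and cov: "\<And>m. cball y (real m) \<subseteq> (\<Union>z\<in>N m. ball z (inverse (real (Suc m))))" by metis
  show ?thesis
  proof (rule that[of "insert y (\<Union>m. N m)"])
    show "countable (insert y (\<Union>m. N m))"
      using fin by (auto intro: countable_finite)
    fix x and e :: real assume "0 < e"
    then obtain m1 where m1: "inverse (real (Suc m1)) < e" using reals_Archimedean by blast
    obtain m2 :: nat where m2: "dist y x \<le> real m2" using real_arch_simple by blast
    \<comment> \<open>One index serves both purposes: the radius is large enough to contain
      \<open>x\<close> and the mesh is finer than \<open>e\<close>.\<close>
    let ?m = "max m1 m2"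
    have "x \<in> cball y (real ?m)" using m2 by simp
    then obtain z where z: "z \<in> N ?m" "dist z x < inverse (real (Suc ?m))" using cov[of ?m] by auto
    have "inverse (real (Suc ?m)) \<le> inverse (real (Suc m1))" by (intro le_imp_inverse_le) auto
    with z(2) m1 have "dist z x < e" by linarith
    then show "\<exists>z\<in>insert y (\<Union>m. N m). dist z x < e" using z(1) by blast
  qed simp
qed

lemma uniform_on_balls:
  fixes F :: "'a::metric_space \<Rightarrow> real" and G :: "nat \<Rightarrow> 'a \<Rightarrow> real"
  assumes proper: "\<And>(x::'a) r. compact (cball x r)"
    and F: "quadratic_growth F y" and G: "\<And>n. 0 < n \<Longrightarrow> quadratic_growth (G n) y"
    and D: "y \<in> D" "\<And>x e. 0 < e \<Longrightarrow> \<exists>z\<in>D. dist z x < e"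
    and conv: "\<And>z. z \<in> D \<Longrightarrow> (\<lambda>n. G n z) \<longlonglongrightarrow> F z" and "0 < e"
  shows "\<forall>\<^sub>F n in sequentially. \<forall>p\<in>cball y R. \<bar>G n p - F p\<bar> < e"
proof -
  \<comment> \<open>A common Lipschitz constant for \<open>F\<close> and, once
    \<open>G n y < F y + 1\<close>, for \<open>G n\<close> on the ball of radius
    \<open>\<bar>R\<bar> + 1\<close>. The extra 1 in the radius makes room for net points, which lie
    within \<open>d \<le> 1\<close> of the original ball.\<close>
  define k where "k = 2 + 2 * (F y + 1) + 2 * (\<bar>R\<bar> + 1)"
  have k: "0 < k" using quadratic_growth.nonneg[OF F, of y] by (simp add: k_def)
  define d where "d = min 1 (e / (3 * k))"
  have d: "0 < d" "d \<le> 1" "d * k \<le> e / 3" using k \<open>0 < e\<close> by (auto simp: d_def min_def field_simps)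
  have "cball y R \<subseteq> (\<Union>z\<in>D. ball z d)" using D(2)[OF d(1)] by (auto simp: subset_eq)
  then obtain N where N: "N \<subseteq> D" "finite N" "cball y R \<subseteq> (\<Union>z\<in>N. ball z d)"
    using compactE_image[OF proper[of y R], of D "\<lambda>z. ball z d"] by auto
  have "\<forall>\<^sub>F n in sequentially. \<bar>G n z - F z\<bar> < e / 3" if "z \<in> N" for z
    using tendstoD[OF conv, of z "e/3"] that N(1) \<open>0 < e\<close> by (auto simp: dist_real_def)
  then have "\<forall>\<^sub>F n in sequentially. \<forall>z\<in>N. \<bar>G n z - F z\<bar> < e / 3"
    by (intro eventually_ball_finite N ballI)
  moreover have "\<forall>\<^sub>F n in sequentially. G n y < F y + 1"
    by (rule order_tendstoD(2)[OF conv[OF D(1)]]) simp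
  ultimately show ?thesis using eventually_gt_at_top[of 0]
  proof eventually_elim
    fix n :: nat assume close: "\<forall>z\<in>N. \<bar>G n z - F z\<bar> < e / 3" and y: "G n y < F y + 1" and n: "0 < n"
    interpret F: quadratic_growth F y by (rule F)
    interpret G: quadratic_growth "G n" y by (rule G[OF n])
    show "\<forall>p\<in>cball y R. \<bar>G n p - F p\<bar> < e"
    proof
      fix p assume p: "p \<in> cball y R"
      then obtain z where z: "z \<in> N" "dist z p < d" using N(3) by auto
      have bounds: "dist y p \<le> \<bar>R\<bar> + 1" "dist y z \<le> \<bar>R\<bar> + 1"
        using p z d dist_triangle[of y z p] by (auto simp: dist_commute)
      have "\<bar>G n p - G n z\<bar> \<le> dist p z * (2 + 2 * G n y + 2 * (\<bar>R\<bar> + 1))"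
        by (rule G.lipschitz[OF bounds])
      also have "\<dots> \<le> d * k"
        using z y d G.nonneg[of y] by (intro mult_mono) (auto simp: k_def dist_commute)
      finally have 1: "\<bar>G n p - G n z\<bar> \<le> e / 3" using d by simp
      have "\<bar>F p - F z\<bar> \<le> dist p z * (2 + 2 * F y + 2 * (\<bar>R\<bar> + 1))"
        by (rule F.lipschitz[OF bounds])
      also have "\<dots> \<le> d * k"
        using z d F.nonneg[of y] by (intro mult_mono) (auto simp: k_def dist_commute)
      finally have 2: "\<bar>F p - F z\<bar> \<le> e / 3" using d by simp
      have "\<bar>G n z - F z\<bar> < e / 3" using close z by blast
      with 1 2 show "\<bar>G n p - F p\<bar> < e" by linarith
    qed
  qed
qed

lemma minimisers_close:
  fixes F :: "'a::metric_space \<Rightarrow> real" and G :: "nat \<Rightarrow> 'a \<Rightarrow> real"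
  assumes proper: "\<And>(x::'a) r. compact (cball x r)"
    and F: "quadratic_growth F y" and G: "\<And>n. 0 < n \<Longrightarrow> quadratic_growth (G n) y"
    and D: "y \<in> D" "\<And>x e. 0 < e \<Longrightarrow> \<exists>z\<in>D. dist z x < e"
    and conv: "\<And>z. z \<in> D \<Longrightarrow> (\<lambda>n. G n z) \<longlonglongrightarrow> F z" and "0 < e"
  shows "\<forall>\<^sub>F n in sequentially. \<forall>p\<in>minimisers (G n). \<exists>u\<in>minimisers F. dist p u < e"
proof -
  interpret F: quadratic_growth F y by (rule F)
  have min_iff: "u \<in> minimisers f \<longleftrightarrow> (\<forall>p. f u \<le> f p)" for u :: 'a and f :: "'a \<Rightarrow> real"
    by (auto simp: minimisers_def is_arg_min_def not_less)
  obtain u0 where u0: "\<And>p. F u0 \<le> F p" using F.minimiser_exists[OF proper] by blast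
  \<comment> \<open>Chosen so that the ball contains the minimisers of \<open>F\<close> and also
    those of \<open>G n\<close> as soon as \<open>G n y < F y + 1\<close>.\<close>
  define R where "R = sqrt (4 * (F y + 1))"
  have in_ball: "x \<in> cball y R" if "(dist y x)\<^sup>2 \<le> 4 * (F y + 1)" for x
    using real_le_rsqrt[OF that] by (simp add: R_def)
  have u0R: "u0 \<in> cball y R"
    by (rule in_ball, rule order_trans[OF F.minimiser_bound[OF u0]]) simp
  define C where "C = cball y R - (\<Union>u\<in>minimisers F. ball u e)"
  have "compact C" unfolding C_def by (intro compact_diff proper) auto
  \<comment> \<open>By compactness \<open>F\<close> stays above its minimum by a positive gap on
    \<open>C\<close>. The gap is split as \<open>2 * h\<close> because \<open>G n\<close> replaces
    \<open>F\<close> at two points, the sample minimiser and \<open>u0\<close>, each time with an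
    error below \<open>h\<close>.\<close>
  have "\<exists>h>0. \<forall>p\<in>C. F u0 + 2 * h \<le> F p"
  proof (cases "C = {}")
    case False
    have "continuous_on C F" using F.continuous_on_cball by (rule continuous_on_subset) (auto simp: C_def)
    then obtain z where z: "z \<in> C" "\<And>p. p \<in> C \<Longrightarrow> F z \<le> F p"
      using continuous_attains_inf[OF \<open>compact C\<close> False] by blast
    have "z \<notin> minimisers F" using z(1) \<open>0 < e\<close> by (force simp: C_def)
    then obtain p where "F p < F z" by (auto simp: min_iff not_le)
    then have "F u0 < F z" using u0[of p] by linarith
    then show ?thesis using z(2) by (intro exI[of _ "(F z - F u0) / 2"]) (auto simp: field_simps)
  qed (auto intro: exI[of _ 1])
  then obtain h where h: "0 < h" "\<And>p. p \<in> C \<Longrightarrow> F u0 + 2 * h \<le> F p" by blast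
  have "\<forall>\<^sub>F n in sequentially. G n y < F y + 1"
    by (rule order_tendstoD(2)[OF conv[OF D(1)]]) simp
  moreover have "\<forall>\<^sub>F n in sequentially. \<forall>p\<in>cball y R. \<bar>G n p - F p\<bar> < h"
    using proper F G D conv h(1) by (rule uniform_on_balls)
  ultimately show ?thesis using eventually_gt_at_top[of 0]
  proof eventually_elim
    fix n :: nat assume y: "G n y < F y + 1" and close: "\<forall>p\<in>cball y R. \<bar>G n p - F p\<bar> < h" and n: "0 < n"
    interpret G: quadratic_growth "G n" y by (rule G[OF n])
    show "\<forall>p\<in>minimisers (G n). \<exists>u\<in>minimisers F. dist p u < e"
    proof
      fix p assume "p \<in> minimisers (G n)"
      then have p: "\<And>q. G n p \<le> G n q" by (simp add: min_iff)
      have pR: "p \<in> cball y R"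
        by (rule in_ball, rule order_trans[OF G.minimiser_bound[OF p]]) (use y in simp)
      have "\<bar>G n p - F p\<bar> < h" "\<bar>G n u0 - F u0\<bar> < h" using close pR u0R by auto
      then have "F p < F u0 + 2 * h" using p[of u0] by linarith
      then have "p \<notin> C" using h(2)[of p] by auto
      then show "\<exists>u\<in>minimisers F. dist p u < e" using pR by (auto simp: C_def dist_commute)
    qed
  qed
qed

lemma excess_le:
  assumes "\<forall>p\<in>S. \<exists>u\<in>T. dist p u < e" shows "excess S T \<le> ennreal e"
  unfolding excess_def
proof (rule SUP_least)
  fix p assume "p \<in> S"
  then obtain u where "u \<in> T" "dist p u < e" using assms by blast
  then show "(INF u\<in>T. ennreal (dist p u)) \<le> ennreal e"
    by (intro INF_lower2[of u] ennreal_leI) auto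
qed

lemma excess_tendsto_0:
  assumes "\<And>e. 0 < e \<Longrightarrow> \<forall>\<^sub>F n in sequentially. \<forall>p\<in>S n. \<exists>u\<in>T. dist p u < e"
  shows "(\<lambda>n. excess (S n) T) \<longlonglongrightarrow> 0"
proof (rule order_tendstoI)
  fix a :: ennreal assume "0 < a"
  \<comment> \<open>A value strictly below \<open>a\<close> turns the weak bound on the excess into
    the strict one, and it is finite even if \<open>a\<close> is not.\<close>
  then obtain b where b: "0 < b" "b < a" using dense by blast
  then obtain e where e: "b = ennreal e" by (cases b) auto
  then have "0 < e" using b by simp
  from assms[OF this] show "\<forall>\<^sub>F n in sequentially. excess (S n) T < a"
    by eventually_elim (use b e in \<open>auto dest!: excess_le\<close>)
qed auto

section \<open>Quadratic growth of the sample and population Frechet functions\<close>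

lemma quadratic_growth_sample:
  assumes "0 < n" shows "quadratic_growth (sample_frechet_fun X n w) y"
proof
  let ?F = "sample_frechet_fun X n w"
  \<comment> \<open>Constants average to themselves only for positive \<open>n\<close>. At
    \<open>n = 0\<close> the sample function is identically 0 and cannot grow, which explains the
    premise.\<close>
  have avg: "c + d * ?F p + b * ?F q = (1 / real n) * (\<Sum>k<n. c + d * (dist (X k w) p)\<^sup>2 + b * (dist (X k w) q)\<^sup>2)"
    for b c d p q
    using assms by (simp add: sample_frechet_fun_def sum.distrib sum_distrib_left[symmetric] field_simps)
  fix p q
  show "(dist p q)\<^sup>2 \<le> 2 * ?F p + 2 * ?F q"
  proof -
    have "(dist p q)\<^sup>2 = (1 / real n) * (\<Sum>k<n. (dist p q)\<^sup>2)" using assms by simp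
    also have "\<dots> \<le> (1 / real n) * (\<Sum>k<n. 0 + 2 * (dist (X k w) p)\<^sup>2 + 2 * (dist (X k w) q)\<^sup>2)"
      using dist_sq_le by (intro mult_left_mono sum_mono) auto
    also have "\<dots> = 0 + 2 * ?F p + 2 * ?F q" by (rule avg[symmetric])
    finally show ?thesis by simp
  qed
  fix R assume R: "dist y p \<le> R" "dist y q \<le> R"
  show "\<bar>?F p - ?F q\<bar> \<le> dist p q * (2 + 2 * ?F y + 2 * R)"
  proof -
    have "?F p - ?F q = (1 / real n) * (\<Sum>k<n. (dist (X k w) p)\<^sup>2 - (dist (X k w) q)\<^sup>2)"
      using avg[of 0 1 p "-1" q] by simp
    also have "\<bar>\<dots>\<bar> \<le> (1 / real n) * (\<Sum>k<n. \<bar>(dist (X k w) p)\<^sup>2 - (dist (X k w) q)\<^sup>2\<bar>)"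
      by (simp add: abs_mult divide_right_mono)
    also have "\<dots> \<le> (1 / real n) * (\<Sum>k<n. dist p q * (2 + 2 * R) + (dist p q * 2) * (dist (X k w) y)\<^sup>2 + 0 * (dist (X k w) y)\<^sup>2)"
      using dist_sq_diff_le[OF R] by (intro mult_left_mono sum_mono) (auto simp: algebra_simps)
    also have "\<dots> = dist p q * (2 + 2 * R) + (dist p q * 2) * ?F y + 0 * ?F y" by (rule avg[symmetric])
    finally show ?thesis by (simp add: algebra_simps)
  qed
qed

text \<open>Finiteness spreads from \<open>p0\<close> to all points by the inequality \<open>(dist x
  p)\<^sup>2 \<le> 2 * (dist x p0)\<^sup>2 + 2 * (dist p p0)\<^sup>2\<close>.\<close>

lemma integrable_dist_sq:
  fixes L :: "'a::metric_space measure"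
  assumes "prob_space L" and sets: "sets L = sets borel" and fin: "frechet_fun L p0 < \<infinity>"
  shows "integrable L (\<lambda>x. (dist x p)\<^sup>2)"
proof -
  interpret prob_space L by fact
  have m [measurable]: "(\<lambda>x. (dist x q)\<^sup>2) \<in> borel_measurable L" for q
    unfolding measurable_cong_sets[OF sets refl]
    by (intro borel_measurable_continuous_onI continuous_intros)
  have i: "integrable L (\<lambda>x. (dist x p0)\<^sup>2)"
    using fin by (intro integrableI_nonneg m) (auto simp: frechet_fun_def)
  show ?thesis
  proof (rule Bochner_Integration.integrable_bound)
    show "integrable L (\<lambda>x. 2 * (dist x p0)\<^sup>2 + 2 * (dist p p0)\<^sup>2)" using i by simp
    show "AE x in L. norm ((dist x p)\<^sup>2) \<le> norm (2 * (dist x p0)\<^sup>2 + 2 * (dist p p0)\<^sup>2)"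
      using dist_sq_le[of _ p p0] by (intro AE_I2) (auto simp: dist_commute)
  qed (rule m)
qed

lemma quadratic_growth_integral:
  fixes L :: "'a::metric_space measure"
  assumes "prob_space L" and int [simp]: "\<And>p. integrable L (\<lambda>x. (dist x p)\<^sup>2)"
  shows "quadratic_growth (\<lambda>p. \<integral>x. (dist x p)\<^sup>2 \<partial>L) y"
proof
  interpret prob_space L by fact
  fix p q :: 'a
  have "(dist p q)\<^sup>2 = (\<integral>x. (dist p q)\<^sup>2 \<partial>L)" by (simp add: prob_space)
  also have "\<dots> \<le> (\<integral>x. 2 * (dist x p)\<^sup>2 + 2 * (dist x q)\<^sup>2 \<partial>L)"
    by (intro integral_mono) (auto simp: dist_sq_le)
  finally show "(dist p q)\<^sup>2 \<le> 2 * (\<integral>x. (dist x p)\<^sup>2 \<partial>L) + 2 * (\<integral>x. (dist x q)\<^sup>2 \<partial>L)" by simp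
  fix R assume R: "dist y p \<le> R" "dist y q \<le> R"
  have "\<bar>(\<integral>x. (dist x p)\<^sup>2 \<partial>L) - (\<integral>x. (dist x q)\<^sup>2 \<partial>L)\<bar> = \<bar>\<integral>x. (dist x p)\<^sup>2 - (dist x q)\<^sup>2 \<partial>L\<bar>" by simp
  also have "\<dots> \<le> (\<integral>x. \<bar>(dist x p)\<^sup>2 - (dist x q)\<^sup>2\<bar> \<partial>L)" by (rule integral_abs_bound)
  also have "\<dots> \<le> (\<integral>x. dist p q * (2 + 2 * (dist x y)\<^sup>2 + 2 * R) \<partial>L)"
    using dist_sq_diff_le[OF R] by (intro integral_mono) auto
  also have "\<dots> = dist p q * (2 + 2 * (\<integral>x. (dist x y)\<^sup>2 \<partial>L) + 2 * R)" by (simp add: prob_space)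
  finally show "\<bar>(\<integral>x. (dist x p)\<^sup>2 \<partial>L) - (\<integral>x. (dist x q)\<^sup>2 \<partial>L)\<bar>
    \<le> dist p q * (2 + 2 * (\<integral>x. (dist x y)\<^sup>2 \<partial>L) + 2 * R)" .
qed

theorem theorem4p3:
  fixes P :: "'w measure"
    and A :: "nat \<Rightarrow> 'w measure"
    and K :: "'a::metric_space \<Rightarrow> 'a measure"
    and X :: "nat \<Rightarrow> 'w \<Rightarrow> 'a"
    and L :: "'a measure"
    and p0 :: 'a
  assumes proper: "\<And>(x::'a) r. compact (cball x r)"
    and chain: "markov_chain P A K X"
    and ergodic: "ergodic_prob K L"
    and initial: "distr P borel (X 0) = L"
    and finite: "frechet_fun L p0 < \<infinity>"
  shows "AE w in P.
    (\<lambda>n. excess (minimisers (sample_frechet_fun X n w)) (minimisers (frechet_fun L))) \<longlonglongrightarrow> 0"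
proof -
  interpret stationary_chain K L P A X
    using chain ergodic initial by unfold_locales (simp_all add: markov_chain_def)
  define F where "F p = (\<integral>x. (dist x p)\<^sup>2 \<partial>L)" for p
  have int: "integrable L (\<lambda>x. (dist x p)\<^sup>2)" for p
    by (rule integrable_dist_sq[OF L.prob_space_axioms sets_L finite])
  have F: "quadratic_growth F p0"
    unfolding F_def by (rule quadratic_growth_integral[OF L.prob_space_axioms int])
  have "frechet_fun L p = ennreal (F p)" for p
    unfolding frechet_fun_def F_def by (intro nn_integral_eq_integral int) simp
  \<comment> \<open>Being finite everywhere, the extended-valued function orders points exactly as
    its real version does.\<close>
  then have min_eq: "minimisers (frechet_fun L) = minimisers F"
    using quadratic_growth.nonneg[OF F]
    by (auto simp: minimisers_def is_arg_min_def ennreal_less_iff)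
  obtain D where D: "countable D" "p0 \<in> D" "\<And>x e. 0 < e \<Longrightarrow> \<exists>z\<in>D. dist z x < e"
    using proper_separable[OF proper] by metis
  have "AE w in P. (\<lambda>n. sample_frechet_fun X n w z) \<longlonglongrightarrow> F z" for z
    using birkhoff[OF int, of z] by (simp add: sample_frechet_fun_def F_def)
  \<comment> \<open>The exceptional null set of the ergodic theorem depends on \<open>z\<close>;
    countability of \<open>D\<close> merges them into one.\<close>
  then have "AE w in P. \<forall>z\<in>D. (\<lambda>n. sample_frechet_fun X n w z) \<longlonglongrightarrow> F z"
    by (simp add: AE_ball_countable[OF D(1)])
  then show ?thesis unfolding min_eq
  proof eventually_elim
    fix w assume conv: "\<forall>z\<in>D. (\<lambda>n. sample_frechet_fun X n w z) \<longlonglongrightarrow> F z"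
    show "(\<lambda>n. excess (minimisers (sample_frechet_fun X n w)) (minimisers F)) \<longlonglongrightarrow> 0"
      by (rule excess_tendsto_0, rule minimisers_close[OF proper F quadratic_growth_sample D(2,3)])
         (use conv in auto)
  qed
qed

end
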